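(* Let $X$ be a Banach space of type $p$, $1<p\le2$, and let $S:l_1\to X$ be a bounded linear operator. Let $D_\sigma:l_1\to l_1$, $D_\sigma((\xi_n)_n)=(\sigma_n\xi_n)_n$, be the diagonal operator induced by the non-increasing and non-negative sequence $\sigma=(\sigma_n)_n$. Then for the composition operator $T=SD_\sigma$ the following statements hold: (i) If $0<r<p'$ and $0<s\le\infty$, then $$(\sigma_{2^{n-1}})_n\in l_{r,s}\quad\text{implies}\quad(e_n(T))_n\in l_{p',s,\alpha}\quad\text{with }\alpha=\frac1s+\frac1{p'}-\frac1r.$$ (ii) If $p'<r<\infty$, $0<s\le\infty$ and $\beta\in\mathbb R$, then $$(\sigma_{2^{n-1}})_n\in l_{r,s,\beta}\quad\text{implies}\quad(e_n(T))_n\in l_{r,s,\beta}.$$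
   Context: $p'$ is the conjugate exponent, $1/p+1/p'=1$; $1/s=0$ for $s=\infty$. $\log$ is the logarithm to base 2. A Banach space $X$ is of type $p$, $1\le p\le2$, if there is $\varrho>0$ with $\int_0^1\|\sum_{i=1}^k r_i(t)x_i\|\,dt\le\varrho(\sum_{i=1}^k\|x_i\|^p)^{1/p}$ for all $k\in\mathbb N$ and $x_1,\dots,x_k\in X$, where $r_i(t)=\mathrm{sign}(\sin(2^i\pi t))$. Entropy numbers: for a bounded subset $A$ of a metric space $M$, $\varepsilon_n(A)=\inf\{\varepsilon\ge0:\exists x_1,\dots,x_n\in M,\ A\subset\bigcup_{i=1}^n B_M(x_i,\varepsilon)\}$ with closed balls, $e_n(A)=\varepsilon_{2^{n-1}}(A)$; for a bounded linear operator $T:X\to Y$ between Banach spaces, $e_n(T)=e_n(T(B_X))$ with $B_X$ the closed unit ball of $X$. Generalized Lorentz sequence spaces: for $0<r<\infty$, $0<s\le\infty$, $\alpha\in\mathbb R$, a non-increasing bounded sequence $(\xi_n)_{n\ge1}$ of non-negative reals belongs to $l_{r,s,\alpha}$ iff $\sum_{n=1}^\infty(\log(n+1))^{-\alpha s}n^{s/r-1}\xi_n^s<\infty$ (if $s<\infty$), respectively $\sup_{n}(\log(n+1))^{-\alpha}n^{1/r}\xi_n<\infty$ (if $s=\infty$). One writes $l_{r,s}=l_{r,s,0}$. *)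

theory Defs
  imports "HOL-Analysis.Analysis"
begin

text \<open>
  Sequences \<open>(\<xi>\<^sub>n)\<^sub>n\<^sub>\<ge>\<^sub>1\<close> are functions on \<open>nat\<close> whose value at index \<open>0\<close> is irrelevant.
  Scalars are real. For the Banach space \<open>l1\<close> the unused coordinate \<open>0\<close> is fixed to be \<open>0\<close>,
  so that its elements correspond exactly to the absolutely summable sequences indexed by
  \<open>{1, 2, \<dots>}\<close>.
\<close>

typedef l1 = "{x :: nat \<Rightarrow> real. x 0 = 0 \<and> summable (\<lambda>n. \<bar>x n\<bar>)}"
  morphisms l1_nth Abs_l1
  by (rule exI[of _ "\<lambda>_. 0"]) auto

setup_lifting type_definition_l1

lemma l1_nth_0 [simp]: "l1_nth x 0 = 0"
  by transfer simp

lemma summable_abs_l1_nth: "summable (\<lambda>n. \<bar>l1_nth x n\<bar>)"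
  by transfer simp

lemma l1_eqI: "(\<And>n. l1_nth x n = l1_nth y n) \<Longrightarrow> x = y"
  by transfer auto

instantiation l1 :: real_vector
begin

lift_definition zero_l1 :: l1 is "\<lambda>_. 0" by simp

lift_definition uminus_l1 :: "l1 \<Rightarrow> l1" is "\<lambda>x n. - x n" by simp

lift_definition plus_l1 :: "l1 \<Rightarrow> l1 \<Rightarrow> l1" is "\<lambda>x y n. x n + y n"
proof (intro conjI)
  fix x y :: "nat \<Rightarrow> real"
  assume x: "x 0 = 0 \<and> summable (\<lambda>n. \<bar>x n\<bar>)" and y: "y 0 = 0 \<and> summable (\<lambda>n. \<bar>y n\<bar>)"
  then show "x 0 + y 0 = 0" by simp
  show "summable (\<lambda>n. \<bar>x n + y n\<bar>)"
    by (rule summable_comparison_test'[where g = "\<lambda>n. \<bar>x n\<bar> + \<bar>y n\<bar>" and N = 0])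
      (use x y in \<open>auto intro: summable_add\<close>)
qed

lift_definition minus_l1 :: "l1 \<Rightarrow> l1 \<Rightarrow> l1" is "\<lambda>x y n. x n - y n"
proof (intro conjI)
  fix x y :: "nat \<Rightarrow> real"
  assume x: "x 0 = 0 \<and> summable (\<lambda>n. \<bar>x n\<bar>)" and y: "y 0 = 0 \<and> summable (\<lambda>n. \<bar>y n\<bar>)"
  then show "x 0 - y 0 = 0" by simp
  show "summable (\<lambda>n. \<bar>x n - y n\<bar>)"
    by (rule summable_comparison_test'[where g = "\<lambda>n. \<bar>x n\<bar> + \<bar>y n\<bar>" and N = 0])
      (use x y in \<open>auto intro: summable_add\<close>)
qed

lift_definition scaleR_l1 :: "real \<Rightarrow> l1 \<Rightarrow> l1" is "\<lambda>c x n. c * x n"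
  by (auto simp: abs_mult intro: summable_mult)

instance
  by standard (transfer, simp add: fun_eq_iff algebra_simps)+

end

instantiation l1 :: real_normed_vector
begin

lift_definition norm_l1 :: "l1 \<Rightarrow> real" is "\<lambda>x. \<Sum>n. \<bar>x n\<bar>" .

definition dist_l1 :: "l1 \<Rightarrow> l1 \<Rightarrow> real"
  where "dist_l1 x y = norm (x - y)"

definition sgn_l1 :: "l1 \<Rightarrow> l1"
  where "sgn_l1 x = x /\<^sub>R norm x"

definition uniformity_l1 :: "(l1 \<times> l1) filter"
  where "uniformity_l1 = (INF e\<in>{0<..}. principal {(x, y). dist x y < e})"

definition open_l1 :: "l1 set \<Rightarrow> bool"
  where "open_l1 U = (\<forall>x\<in>U. \<forall>\<^sub>F (x', y) in uniformity. x' = x \<longrightarrow> y \<in> U)"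

instance
proof
  fix x y :: l1 and a :: real and U :: "l1 set"
  show "dist x y = norm (x - y)" by (fact dist_l1_def)
  show "sgn x = x /\<^sub>R norm x" by (fact sgn_l1_def)
  show "uniformity = (INF e\<in>{0<..}. principal {(x :: l1, y). dist x y < e})"
    by (fact uniformity_l1_def)
  show "open U \<longleftrightarrow> (\<forall>x\<in>U. \<forall>\<^sub>F (x', y) in uniformity. x' = x \<longrightarrow> y \<in> U)"
    by (fact open_l1_def)
  show "norm x = 0 \<longleftrightarrow> x = 0"
    by transfer (auto simp: suminf_eq_zero_iff)
  show "norm (x + y) \<le> norm x + norm y"
  proof transfer
    fix x y :: "nat \<Rightarrow> real"
    assume x: "x 0 = 0 \<and> summable (\<lambda>n. \<bar>x n\<bar>)" and y: "y 0 = 0 \<and> summable (\<lambda>n. \<bar>y n\<bar>)"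
    have s: "summable (\<lambda>n. \<bar>x n + y n\<bar>)"
      by (rule summable_comparison_test'[where g = "\<lambda>n. \<bar>x n\<bar> + \<bar>y n\<bar>" and N = 0])
        (use x y in \<open>auto intro: summable_add\<close>)
    have "(\<Sum>n. \<bar>x n + y n\<bar>) \<le> (\<Sum>n. \<bar>x n\<bar> + \<bar>y n\<bar>)"
      using x y s by (intro suminf_le summable_add) auto
    also have "\<dots> = (\<Sum>n. \<bar>x n\<bar>) + (\<Sum>n. \<bar>y n\<bar>)"
      using x y by (simp add: suminf_add)
    finally show "(\<Sum>n. \<bar>x n + y n\<bar>) \<le> (\<Sum>n. \<bar>x n\<bar>) + (\<Sum>n. \<bar>y n\<bar>)" .
  qed
  show "norm (a *\<^sub>R x) = \<bar>a\<bar> * norm x"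
    by transfer (simp add: abs_mult suminf_mult)
qed

end

lemma sum_abs_le_norm_l1: "(\<Sum>n<k. \<bar>l1_nth x n\<bar>) \<le> norm x"
  unfolding norm_l1.rep_eq by (rule sum_le_suminf[OF summable_abs_l1_nth]) auto

lemma abs_l1_nth_le_norm: "\<bar>l1_nth x n\<bar> \<le> norm x"
proof -
  have "\<bar>l1_nth x n\<bar> \<le> (\<Sum>i<Suc n. \<bar>l1_nth x i\<bar>)"
    by (simp add: sum_nonneg)
  then show ?thesis using sum_abs_le_norm_l1[of x "Suc n"] by linarith
qed

instance l1 :: banach
proof
  fix X :: "nat \<Rightarrow> l1"
  assume X: "Cauchy X"
  have "Cauchy (\<lambda>k. l1_nth (X k) n)" for n
  proof (rule metric_CauchyI)
    fix e :: real assume "0 < e"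
    then obtain M where M: "\<And>k m. k \<ge> M \<Longrightarrow> m \<ge> M \<Longrightarrow> dist (X k) (X m) < e"
      using metric_CauchyD[OF X] by blast
    have "dist (l1_nth (X k) n) (l1_nth (X m) n) \<le> dist (X k) (X m)" for k m
      using abs_l1_nth_le_norm[of "X k - X m" n]
      by (simp add: dist_norm minus_l1.rep_eq)
    then show "\<exists>M. \<forall>m\<ge>M. \<forall>n'\<ge>M. dist (l1_nth (X m) n) (l1_nth (X n') n) < e"
      using M by (meson le_less_trans)
  qed
  then have "\<exists>y. (\<lambda>k. l1_nth (X k) n) \<longlonglongrightarrow> y" for n
    using Cauchy_convergent convergent_def by blast
  then obtain y where y: "\<And>n. (\<lambda>k. l1_nth (X k) n) \<longlonglongrightarrow> y n" by metis
  have part: "\<exists>M. \<forall>m\<ge>M. \<forall>K. (\<Sum>n<K. \<bar>l1_nth (X m) n - y n\<bar>) \<le> e" if "0 < e" for e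
  proof -
    obtain M where M: "\<And>k m. k \<ge> M \<Longrightarrow> m \<ge> M \<Longrightarrow> dist (X k) (X m) < e"
      using metric_CauchyD[OF X \<open>0 < e\<close>] by blast
    have "(\<Sum>n<K. \<bar>l1_nth (X m) n - y n\<bar>) \<le> e" if "m \<ge> M" for m K
    proof (rule LIMSEQ_le_const2)
      show "(\<lambda>k. \<Sum>n<K. \<bar>l1_nth (X m) n - l1_nth (X k) n\<bar>) \<longlonglongrightarrow> (\<Sum>n<K. \<bar>l1_nth (X m) n - y n\<bar>)"
        by (intro tendsto_intros y)
      have "(\<Sum>n<K. \<bar>l1_nth (X m) n - l1_nth (X k) n\<bar>) \<le> e" if "k \<ge> M" for k
        using sum_abs_le_norm_l1[of "X m - X k" K] M[OF \<open>m \<ge> M\<close> that]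
        by (simp add: dist_norm minus_l1.rep_eq)
      then show "\<exists>N. \<forall>k\<ge>N. (\<Sum>n<K. \<bar>l1_nth (X m) n - l1_nth (X k) n\<bar>) \<le> e" by blast
    qed
    then show ?thesis by blast
  qed
  have y0: "y 0 = 0"
    using y[of 0] by (simp add: LIMSEQ_const_iff)
  have diff: "summable (\<lambda>n. \<bar>l1_nth (X m) n - y n\<bar>)"
    if "\<forall>K. (\<Sum>n<K. \<bar>l1_nth (X m) n - y n\<bar>) \<le> e" for m e
    using that by (intro bounded_imp_summable[where B = e])
      (auto simp: lessThan_Suc_atMost[symmetric] simp del: sum.lessThan_Suc)
  obtain m where m: "\<forall>K. (\<Sum>n<K. \<bar>l1_nth (X m) n - y n\<bar>) \<le> 1"
    using part[of 1] by auto
  have "summable (\<lambda>n. \<bar>y n\<bar>)"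
    by (rule summable_comparison_test'
          [where g = "\<lambda>n. \<bar>l1_nth (X m) n\<bar> + \<bar>l1_nth (X m) n - y n\<bar>" and N = 0])
      (use diff[OF m] summable_abs_l1_nth in \<open>auto intro: summable_add\<close>)
  then have nth: "l1_nth (Abs_l1 y) n = y n" for n
    using y0 by (simp add: Abs_l1_inverse)
  have "X \<longlonglongrightarrow> Abs_l1 y"
  proof (rule metric_LIMSEQ_I)
    fix e :: real assume "0 < e"
    then obtain M where M: "\<forall>m\<ge>M. \<forall>K. (\<Sum>n<K. \<bar>l1_nth (X m) n - y n\<bar>) \<le> e / 2"
      using part[of "e / 2"] by auto
    have "dist (X m) (Abs_l1 y) < e" if "m \<ge> M" for m
    proof -
      have *: "\<forall>K. (\<Sum>n<K. \<bar>l1_nth (X m) n - y n\<bar>) \<le> e / 2" using M that by blast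
      have "norm (X m - Abs_l1 y) = (\<Sum>n. \<bar>l1_nth (X m) n - y n\<bar>)"
        by (simp add: norm_l1.rep_eq minus_l1.rep_eq nth)
      also have "\<dots> \<le> e / 2"
        using * by (intro suminf_le_const diff[OF *]) auto
      finally show ?thesis using \<open>0 < e\<close> by (simp add: dist_norm)
    qed
    then show "\<exists>M. \<forall>m\<ge>M. dist (X m) (Abs_l1 y) < e" by blast
  qed
  then show "convergent X" by (auto simp: convergent_def)
qed

text \<open>
  The diagonal operator is only meaningful for bounded \<open>\<sigma>\<close>; the lemmas below confirm that it has
  the intended coordinates, and is bounded and linear, for non-increasing non-negative \<open>\<sigma>\<close>.
\<close>

definition diag_op :: "(nat \<Rightarrow> real) \<Rightarrow> l1 \<Rightarrow> l1"
  where "diag_op \<sigma> x = Abs_l1 (\<lambda>n. \<sigma> n * l1_nth x n)"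

lemma l1_nth_diag_op:
  assumes "antimono_on {1..} \<sigma>" and "\<forall>n\<ge>1. 0 \<le> \<sigma> n"
  shows "l1_nth (diag_op \<sigma> x) n = \<sigma> n * l1_nth x n"
proof -
  have le: "\<bar>\<sigma> n * l1_nth x n\<bar> \<le> \<sigma> 1 * \<bar>l1_nth x n\<bar>" for n
  proof (cases "n = 0")
    case False
    then have "\<sigma> n \<le> \<sigma> 1" "0 \<le> \<sigma> n"
      using assms by (auto simp: monotone_on_def)
    then show ?thesis by (auto simp: abs_mult intro: mult_right_mono)
  qed simp
  have "summable (\<lambda>n. \<bar>\<sigma> n * l1_nth x n\<bar>)"
    by (rule summable_comparison_test'[where g = "\<lambda>n. \<sigma> 1 * \<bar>l1_nth x n\<bar>" and N = 0])
      (use le summable_abs_l1_nth in \<open>auto intro!: summable_mult\<close>)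
  then show ?thesis
    unfolding diag_op_def by (subst Abs_l1_inverse) auto
qed

lemma bounded_linear_diag_op:
  assumes "antimono_on {1..} \<sigma>" and "\<forall>n\<ge>1. 0 \<le> \<sigma> n"
  shows "bounded_linear (diag_op \<sigma>)"
proof (rule bounded_linear_intro)
  note nth = l1_nth_diag_op[OF assms]
  show "diag_op \<sigma> (x + y) = diag_op \<sigma> x + diag_op \<sigma> y" for x y
    by (rule l1_eqI) (simp add: nth plus_l1.rep_eq algebra_simps)
  show "diag_op \<sigma> (c *\<^sub>R x) = c *\<^sub>R diag_op \<sigma> x" for c x
    by (rule l1_eqI) (simp add: nth scaleR_l1.rep_eq algebra_simps)
  fix x
  have le: "\<bar>l1_nth (diag_op \<sigma> x) n\<bar> \<le> \<sigma> 1 * \<bar>l1_nth x n\<bar>" for n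
  proof (cases "n = 0")
    case False
    then have "\<sigma> n \<le> \<sigma> 1" "0 \<le> \<sigma> n"
      using assms by (auto simp: monotone_on_def)
    then show ?thesis by (auto simp: nth abs_mult intro: mult_right_mono)
  qed simp
  have "norm (diag_op \<sigma> x) \<le> (\<Sum>n. \<sigma> 1 * \<bar>l1_nth x n\<bar>)"
    unfolding norm_l1.rep_eq
    by (intro suminf_le le summable_abs_l1_nth summable_mult)
  then show "norm (diag_op \<sigma> x) \<le> norm x * \<sigma> 1"
    by (simp add: norm_l1.rep_eq suminf_mult[OF summable_abs_l1_nth] mult.commute)
qed

definition rademacher :: "nat \<Rightarrow> real \<Rightarrow> real"
  where "rademacher i t = sgn (sin (2 ^ i * pi * t))"

definition has_type :: "'a::banach itself \<Rightarrow> real \<Rightarrow> bool"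
  where "has_type _ p \<longleftrightarrow> 1 \<le> p \<and> p \<le> 2 \<and>
    (\<exists>\<rho>>0. \<forall>k. \<forall>x :: nat \<Rightarrow> 'a.
      integral {0..1} (\<lambda>t. norm (\<Sum>i=1..k. rademacher i t *\<^sub>R x i))
        \<le> \<rho> * (\<Sum>i=1..k. norm (x i) powr p) powr (1 / p))"

text \<open>The numbers \<open>\<epsilon>\<^sub>n\<close> and \<open>e\<^sub>n\<close> are meant for bounded sets and \<open>n \<ge> 1\<close>.\<close>

definition cover_number :: "nat \<Rightarrow> 'a::metric_space set \<Rightarrow> real"
  where "cover_number n A = Inf {\<epsilon>. 0 \<le> \<epsilon> \<and> (\<exists>x :: nat \<Rightarrow> 'a. A \<subseteq> (\<Union>i\<in>{1..n}. cball (x i) \<epsilon>))}"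

definition entropy_number :: "nat \<Rightarrow> 'a::metric_space set \<Rightarrow> real"
  where "entropy_number n A = cover_number (2 ^ (n - 1)) A"

definition op_entropy_number ::
    "nat \<Rightarrow> ('a::real_normed_vector \<Rightarrow> 'b::real_normed_vector) \<Rightarrow> real"
  where "op_entropy_number n T = entropy_number n (T ` cball 0 1)"

text \<open>
  \<open>lorentz r s \<alpha>\<close> is \<open>l\<^sub>r\<^sub>,\<^sub>s\<^sub>,\<^sub>\<alpha>\<close> for \<open>0 < r\<close> and \<open>0 < s \<le> \<infinity>\<close>; \<open>l\<^sub>r\<^sub>,\<^sub>s\<close> is \<open>lorentz r s 0\<close>.
  All summands are non-negative, so unconditional summability is convergence of the series.
\<close>

definition lorentz :: "real \<Rightarrow> ereal \<Rightarrow> real \<Rightarrow> (nat \<Rightarrow> real) set"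
  where "lorentz r s \<alpha> = {\<xi>. antimono_on {1..} \<xi> \<and> (\<forall>n\<ge>1. 0 \<le> \<xi> n) \<and> bounded (\<xi> ` {1..}) \<and>
    (if s = \<infinity>
     then bdd_above ((\<lambda>n. log 2 (real n + 1) powr (- \<alpha>) * real n powr (1 / r) * \<xi> n) ` {1..})
     else (let s' = real_of_ereal s in
       (\<lambda>n. log 2 (real n + 1) powr (- \<alpha> * s') * real n powr (s' / r - 1) * \<xi> n powr s')
         summable_on {1..}))}"

end

theory Submission
  imports Defs
begin

text \<open>
  The image of the unit ball under \<open>S \<circ> diag_op \<sigma>\<close> is essentially the absolutely convex hull of the
  points \<open>\<sigma> k *\<^sub>R S e\<^sub>k\<close>, where \<open>e\<^sub>k\<close> are the unit vectors. The coordinates are grouped into blocks such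
  that \<open>log k\<close> is of order \<open>2 ^ j\<close> on block number \<open>j\<close>; there the weights are at most the entry
  \<open>\<tau> j = \<sigma> (2 ^ (2 ^ j - 1))\<close> of the sequence in the hypothesis.

  One block is covered by Maurey's empirical method (\<open>maurey_approximation\<close>): in a space of type \<open>p\<close>
  every point of a convex hull is approximated by the mean of \<open>k\<close> suitable vertices up to an error of
  order \<open>k powr (- 1 / p')\<close>. A vertex of block \<open>j\<close> is described by \<open>2 ^ (j + 1)\<close> bits, so a mean costs
  \<open>k * 2 ^ (j + 1)\<close> bits. Taking about \<open>2 ^ (J - j) * \<theta> j\<close> vertices in block \<open>j\<close>, with summable \<open>\<theta>\<close>, costs
  \<open>O (2 ^ J)\<close> bits in total and yields, up to constants (\<open>entropy_number_diag_le\<close>),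
  the sum of \<open>\<tau> j * (2 ^ (J - j) * \<theta> j) powr (- 1 / p')\<close> over \<open>j < J\<close>, plus \<open>\<tau> J\<close> for the remaining
  coordinates, as a bound for the entropy number with index of order \<open>2 ^ J\<close>.

  If \<open>r > p'\<close>, the last blocks dominate this sum, and bit shares decaying geometrically in \<open>J - j\<close>
  reproduce the decay of \<open>\<tau>\<close> (\<open>lorentz_above\<close>). If \<open>r < p'\<close>, the first blocks dominate. Blocks
  with much fewer coordinates than \<open>2 ^ J\<close> are therefore rounded coordinatewise, with a negligible
  error, so that the sum starts at \<open>2 ^ j\<close> of order \<open>J\<close>. This gives the rate \<open>2 powr (- J / p')\<close>
  times a power of \<open>J\<close>, that is, of the logarithm of the index (\<open>lorentz_below\<close>).

  To read off membership in Lorentz spaces, both the hypothesis and the conclusion are condensed to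
  dyadic indices (\<open>lorentz_imp_ell_dyadic\<close>, \<open>lorentzI_dyadic\<close>). They become membership of weighted
  sequences in \<open>l\<^sub>s\<close>, and the sums over blocks become convolutions with geometric sequences, which
  preserve \<open>l\<^sub>s\<close> for every \<open>0 < s \<le> \<infinity>\<close> (\<open>ell_geometric_head\<close>, \<open>ell_geometric_tail\<close>).
\<close>

section \<open>Summable and bounded sequences under geometric convolution\<close>

text \<open>
  Index \<open>0\<close> is counted here although the sequences of interest start at \<open>1\<close>; a single term changes
  neither summability nor boundedness.
\<close>

definition ell :: "ereal \<Rightarrow> (nat \<Rightarrow> real) \<Rightarrow> bool"
  where "ell s f \<longleftrightarrow>
    (if s = \<infinity> then bdd_above (range (\<lambda>n. \<bar>f n\<bar>))
     else summable (\<lambda>n. \<bar>f n\<bar> powr real_of_ereal s))"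

lemma ell_cases [consumes 1, case_names infinite finite]:
  assumes "0 < s"
  obtains "s = \<infinity>" | t where "s = ereal t" "0 < t"
  using assms by (cases s) auto

lemma real_of_ereal_one_divide: "0 < t \<Longrightarrow> real_of_ereal (1 / ereal t) = 1 / t"
  by (simp add: one_ereal_def)

lemma ell_infinity: "ell \<infinity> f \<longleftrightarrow> bdd_above (range (\<lambda>n. \<bar>f n\<bar>))"
  by (simp add: ell_def)

lemma ell_infinityI: "(\<And>n. \<bar>f n\<bar> \<le> B) \<Longrightarrow> ell \<infinity> f"
  by (auto simp: ell_infinity intro!: bdd_aboveI2)

lemma ell_ereal: "ell (ereal t) f \<longleftrightarrow> summable (\<lambda>n. \<bar>f n\<bar> powr t)"
  by (simp add: ell_def)

lemma ell_dominated:
  assumes "0 < s" and g: "ell s g" and le: "\<And>n. N \<le> n \<Longrightarrow> \<bar>f n\<bar> \<le> C * \<bar>g n\<bar>"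
  shows "ell s f"
  using \<open>0 < s\<close>
proof (cases rule: ell_cases)
  case infinite
  then obtain B where B: "\<And>n. \<bar>g n\<bar> \<le> B"
    using g by (auto simp: ell_infinity bdd_above_def)
  have "\<bar>f n\<bar> \<le> (\<Sum>i<N. \<bar>f i\<bar>) + \<bar>C\<bar> * B" for n
  proof (cases "n < N")
    case True
    have "\<bar>f n\<bar> \<le> (\<Sum>i<N. \<bar>f i\<bar>)"
      by (rule member_le_sum) (use True in auto)
    moreover have "0 \<le> \<bar>C\<bar> * B" using B[of 0] by simp
    ultimately show ?thesis by simp
  next
    case False
    have "C * \<bar>g n\<bar> \<le> \<bar>C\<bar> * B" using B[of n] by (intro mult_mono) auto
    moreover have "\<bar>f n\<bar> \<le> C * \<bar>g n\<bar>" using False le[of n] by linarith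
    moreover have "0 \<le> (\<Sum>i<N. \<bar>f i\<bar>)" by (intro sum_nonneg abs_ge_zero)
    ultimately show ?thesis by linarith
  qed
  then show ?thesis unfolding infinite by (rule ell_infinityI)
next
  case (finite t)
  have "summable (\<lambda>n. \<bar>C\<bar> powr t * \<bar>g n\<bar> powr t)"
    using g unfolding finite ell_ereal by (rule summable_mult)
  then have "summable (\<lambda>n. \<bar>f n\<bar> powr t)"
  proof (rule summable_comparison_test'[where N = N])
    fix n assume "N \<le> n"
    have "C * \<bar>g n\<bar> \<le> \<bar>C\<bar> * \<bar>g n\<bar>" by (intro mult_right_mono) auto
    with le[OF \<open>N \<le> n\<close>] have "\<bar>f n\<bar> \<le> \<bar>C\<bar> * \<bar>g n\<bar>" by linarith
    then have "\<bar>f n\<bar> powr t \<le> (\<bar>C\<bar> * \<bar>g n\<bar>) powr t"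
      using finite by (intro powr_mono2) auto
    then show "norm (\<bar>f n\<bar> powr t) \<le> \<bar>C\<bar> powr t * \<bar>g n\<bar> powr t"
      by (simp add: powr_mult)
  qed
  then show ?thesis unfolding finite ell_ereal .
qed

lemma ell_shift_iff:
  assumes "0 < s"
  shows "ell s (\<lambda>n. f (n + k)) \<longleftrightarrow> ell s f"
  using assms
proof (cases rule: ell_cases)
  case infinite
  show ?thesis
  proof
    assume "ell s (\<lambda>n. f (n + k))"
    then obtain B where B: "\<And>n. \<bar>f (n + k)\<bar> \<le> B"
      by (auto simp: infinite ell_infinity bdd_above_def)
    have B': "\<bar>f n\<bar> \<le> B" if "k \<le> n" for n using B[of "n - k"] that by simp
    have "ell s (\<lambda>n. if n < k then 0 else B)"
      unfolding infinite by (rule ell_infinityI[of _ "\<bar>B\<bar>"]) auto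
    then show "ell s f"
      by (rule ell_dominated[OF assms, of _ k _ 1]) (use B' in \<open>auto intro: order_trans[OF _ abs_ge_self]\<close>)
  qed (auto simp: infinite ell_infinity bdd_above_def)
next
  case (finite t)
  show ?thesis
    unfolding finite ell_ereal by (rule summable_iff_shift)
qed

lemma powr_add_le:
  fixes a b t :: real
  assumes "0 \<le> a" "0 \<le> b" "0 \<le> t"
  shows "(a + b) powr t \<le> 2 powr t * (a powr t + b powr t)"
proof -
  have "(a + b) powr t \<le> (2 * max a b) powr t"
    using assms by (intro powr_mono2) auto
  also have "\<dots> = 2 powr t * (max a b) powr t"
    using assms by (simp add: powr_mult)
  also have "(max a b) powr t \<le> a powr t + b powr t"
    by (simp add: max_def)
  finally show ?thesis by simp
qed

lemma ell_add:
  assumes "0 < s" "ell s f" "ell s g"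
  shows "ell s (\<lambda>n. f n + g n)"
  using \<open>0 < s\<close>
proof (cases rule: ell_cases)
  case infinite
  then obtain A B where "\<And>n. \<bar>f n\<bar> \<le> A" "\<And>n. \<bar>g n\<bar> \<le> B"
    using assms by (auto simp: ell_infinity bdd_above_def)
  then have "\<bar>f n + g n\<bar> \<le> A + B" for n
    by (meson abs_triangle_ineq add_mono order_trans)
  then show ?thesis unfolding infinite by (rule ell_infinityI)
next
  case (finite t)
  have "summable (\<lambda>n. 2 powr t * (\<bar>f n\<bar> powr t + \<bar>g n\<bar> powr t))"
    using assms unfolding finite ell_ereal by (intro summable_mult summable_add)
  then have "summable (\<lambda>n. \<bar>f n + g n\<bar> powr t)"
  proof (rule summable_comparison_test'[where N = 0])
    fix n
    have "\<bar>f n + g n\<bar> powr t \<le> (\<bar>f n\<bar> + \<bar>g n\<bar>) powr t"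
      using finite by (intro powr_mono2) auto
    also have "\<dots> \<le> 2 powr t * (\<bar>f n\<bar> powr t + \<bar>g n\<bar> powr t)"
      using finite by (intro powr_add_le) auto
    finally show "norm (\<bar>f n + g n\<bar> powr t) \<le> 2 powr t * (\<bar>f n\<bar> powr t + \<bar>g n\<bar> powr t)"
      by simp
  qed
  then show ?thesis unfolding finite ell_ereal .
qed

lemma powr_power_swap: "0 < x \<Longrightarrow> (x ^ m) powr t = (x powr t) ^ m" for x t :: real
  by (simp add: powr_powr powr_realpow[symmetric] mult.commute)

lemma powr_less_one_base:
  fixes x t :: real assumes "0 < x" "x < 1" "0 < t" shows "x powr t < 1"
  using powr_less_mono2[of t x 1] assms by simp

lemma ell_geometric:
  assumes "0 < s" "0 < x" "x < 1"
  shows "ell s (\<lambda>n. x ^ n)"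
  using \<open>0 < s\<close>
proof (cases rule: ell_cases)
  case infinite
  show ?thesis unfolding infinite
    by (rule ell_infinityI[of _ 1]) (use assms in \<open>auto simp: power_le_one\<close>)
next
  case (finite t)
  then show ?thesis
    using assms powr_less_one_base[of x t] by (simp add: ell_ereal powr_power_swap)
qed

text \<open>
  Replacing every \<open>u j\<close> by the largest one gives a bound that holds for all exponents \<open>t > 0\<close>, so
  that neither Hoelder's inequality (\<open>t \<ge> 1\<close>) nor subadditivity of the power (\<open>t \<le> 1\<close>) has to
  be treated separately.
\<close>

lemma weighted_sum_powr_le:
  fixes u v :: "'i \<Rightarrow> real"
  assumes "finite F" and v: "\<And>j. j \<in> F \<Longrightarrow> 0 \<le> v j" and u: "\<And>j. j \<in> F \<Longrightarrow> 0 \<le> u j"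
    and G: "(\<Sum>j\<in>F. v j) \<le> G" and t: "0 < t"
  shows "(\<Sum>j\<in>F. v j * u j) powr t \<le> G powr t * (\<Sum>j\<in>F. u j powr t)"
proof (cases "F = {}")
  case False
  define M where "M = Max (u ` F)"
  have "M \<in> u ` F" unfolding M_def using assms False by (intro Max_in) auto
  then obtain i where i: "i \<in> F" "M = u i" by auto
  have le: "u j \<le> M" if "j \<in> F" for j
    unfolding M_def using assms that by simp
  have "(\<Sum>j\<in>F. v j * u j) \<le> (\<Sum>j\<in>F. v j * M)"
    using le v by (intro sum_mono mult_left_mono) auto
  also have "\<dots> \<le> G * M"
    using G i u by (auto simp: sum_distrib_right[symmetric] intro!: mult_right_mono)
  finally have "(\<Sum>j\<in>F. v j * u j) powr t \<le> (G * M) powr t"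
    using t u v by (intro powr_mono2) (auto intro!: sum_nonneg)
  also have "\<dots> = G powr t * M powr t" by (rule powr_mult)
  also have "M powr t \<le> (\<Sum>j\<in>F. u j powr t)"
    unfolding i(2) by (rule member_le_sum) (use i assms in auto)
  finally show ?thesis by (simp add: mult_left_mono)
qed simp

lemma geometric_partial_sum_le:
  fixes x :: real assumes "0 < x" "x < 1"
  shows "(\<Sum>m<n. x ^ m) \<le> 1 / (1 - x)"
proof -
  have "(\<Sum>m<n. x ^ m) \<le> (\<Sum>m. x ^ m)"
    using assms by (intro sum_le_suminf) auto
  then show ?thesis using assms by (simp add: suminf_geometric)
qed

text \<open>
  The weight \<open>x ^ m\<close> is the square of \<open>sqrt x ^ m\<close>: one factor makes the weights summable, the other
  one stays inside the power and keeps the right-hand side a geometric convolution.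
\<close>

lemma geometric_weighted_sum_powr_le:
  fixes x t :: real and a :: "nat \<Rightarrow> real"
  assumes x: "0 < x" "x < 1" and t: "0 < t" and a: "\<And>m. 0 \<le> a m"
  shows "(\<Sum>m<n. x ^ m * a m) powr t
      \<le> (1 / (1 - sqrt x)) powr t * (\<Sum>m<n. (sqrt x powr t) ^ m * a m powr t)"
proof -
  define y where "y = sqrt x"
  have y: "0 < y" "y < 1" "x = y * y" using x by (auto simp: y_def)
  have "(\<Sum>m<n. x ^ m * a m) = (\<Sum>m<n. y ^ m * (y ^ m * a m))"
    by (simp add: y(3) power_mult_distrib mult.assoc)
  also have "\<dots> powr t \<le> (1 / (1 - y)) powr t * (\<Sum>m<n. (y ^ m * a m) powr t)"
    using y a t geometric_partial_sum_le[of y n] by (intro weighted_sum_powr_le) auto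
  finally show ?thesis
    using y by (simp add: y_def[symmetric] powr_mult powr_power_swap)
qed

text \<open>
  After the pointwise estimate the \<open>t\<close>-th powers form a Cauchy product of two summable sequences.
\<close>

lemma ell_geometric_head:
  assumes s: "0 < s" and x: "0 < x" "x < 1" and a: "\<And>m. 0 \<le> a m" and ell: "ell s a"
  shows "ell s (\<lambda>J. \<Sum>m\<le>J. x ^ m * a (J - m))"
  using s
proof (cases rule: ell_cases)
  case infinite
  then obtain A where A: "\<And>n. a n \<le> A"
    using ell by (auto simp: ell_infinity bdd_above_def abs_le_iff)
  have "\<bar>\<Sum>m\<le>J. x ^ m * a (J - m)\<bar> \<le> 1 / (1 - x) * A" for J
  proof -
    have "\<bar>\<Sum>m\<le>J. x ^ m * a (J - m)\<bar> = (\<Sum>m\<le>J. x ^ m * a (J - m))"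
      using x a by (intro abs_of_nonneg sum_nonneg) auto
    also have "\<dots> \<le> (\<Sum>m\<le>J. x ^ m * A)"
      using A x by (intro sum_mono mult_left_mono) auto
    also have "\<dots> = (\<Sum>m<Suc J. x ^ m) * A"
      by (simp add: sum_distrib_right lessThan_Suc_atMost[symmetric] distrib_right)
    also have "\<dots> \<le> 1 / (1 - x) * A"
      using A[of 0] a[of 0] geometric_partial_sum_le[OF x, of "Suc J"] by (intro mult_right_mono) auto
    finally show ?thesis .
  qed
  then show ?thesis unfolding infinite by (rule ell_infinityI)
next
  case (finite t)
  define z where "z = sqrt x powr t"
  have z: "0 < z" "z < 1" using x finite powr_less_one_base[of "sqrt x" t] by (auto simp: z_def)
  have "summable (\<lambda>J. \<Sum>m\<le>J. z ^ m * a (J - m) powr t)"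
    using z ell a finite by (intro summable_Cauchy_product) (auto simp: ell_ereal)
  then have "summable (\<lambda>J. (1 / (1 - sqrt x)) powr t * (\<Sum>m\<le>J. z ^ m * a (J - m) powr t))"
    by (rule summable_mult)
  then have "summable (\<lambda>J. \<bar>\<Sum>m\<le>J. x ^ m * a (J - m)\<bar> powr t)"
  proof (rule summable_comparison_test'[where N = 0])
    fix J
    have "(\<Sum>m\<le>J. x ^ m * a (J - m)) \<ge> 0"
      using x a by (intro sum_nonneg) auto
    then show "norm (\<bar>\<Sum>m\<le>J. x ^ m * a (J - m)\<bar> powr t)
        \<le> (1 / (1 - sqrt x)) powr t * (\<Sum>m\<le>J. z ^ m * a (J - m) powr t)"
      using geometric_weighted_sum_powr_le[OF x finite(2), of "\<lambda>m. a (J - m)" "Suc J"] a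
      by (simp add: z_def lessThan_Suc_atMost[symmetric] del: sum.lessThan_Suc)
  qed
  then show ?thesis unfolding finite ell_ereal .
qed

text \<open>
  The majorant \<open>h\<close> is used in place of the infinite sums. For finite exponents it is obtained by
  interchanging the order of summation, since every shift of \<open>a powr t\<close> has sum at most the total.
\<close>

lemma ell_geometric_tail:
  assumes s: "0 < s" and x: "0 < x" "x < 1" and a: "\<And>m. 0 \<le> a m" and ell: "ell s a"
  obtains h where "ell s h" "\<And>l n. (\<Sum>m<n. x ^ m * a (l + m)) \<le> h l"
  using s
proof (cases rule: ell_cases)
  case infinite
  then obtain A where A: "\<And>n. a n \<le> A"
    using ell by (auto simp: ell_infinity bdd_above_def abs_le_iff)
  show ?thesis
  proof
    show "ell s (\<lambda>l. 1 / (1 - x) * A)"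
      unfolding infinite by (rule ell_infinityI[of _ "\<bar>1 / (1 - x) * A\<bar>"]) simp
    fix l n
    have "(\<Sum>m<n. x ^ m * a (l + m)) \<le> (\<Sum>m<n. x ^ m * A)"
      using A x by (intro sum_mono mult_left_mono) auto
    also have "\<dots> = (\<Sum>m<n. x ^ m) * A" by (simp add: sum_distrib_right)
    also have "\<dots> \<le> 1 / (1 - x) * A"
      using A[of 0] a[of 0] geometric_partial_sum_le[OF x, of n] by (intro mult_right_mono) auto
    finally show "(\<Sum>m<n. x ^ m * a (l + m)) \<le> 1 / (1 - x) * A" .
  qed
next
  case (finite t)
  define z where "z = sqrt x powr t"
  define G where "G = (1 / (1 - sqrt x)) powr t"
  define b where "b m = a m powr t" for m
  define g where "g l = (\<Sum>m. z ^ m * b (l + m))" for l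
  have z: "0 < z" "z < 1" using x finite powr_less_one_base[of "sqrt x" t] by (auto simp: z_def)
  have b0: "0 \<le> b m" for m by (simp add: b_def)
  have sb: "summable b" using ell a by (simp add: finite ell_ereal b_def[abs_def])
  define B where "B = suminf b"
  have partial: "(\<Sum>l<L. b (l + m)) \<le> B" for L m
  proof -
    have "(\<Sum>l<L. b (l + m)) = sum b {m..<L + m}"
      by (rule sum.reindex_bij_witness[of _ "\<lambda>l. l - m" "\<lambda>l. l + m"]) auto
    also have "\<dots> \<le> B" unfolding B_def by (intro sum_le_suminf sb b0) auto
    finally show ?thesis .
  qed
  have single: "b m \<le> B" for m using partial[of m 1] by simp
  have geo: "summable (\<lambda>m. z ^ m * B)" using z by (intro summable_mult2) simp
  have sg: "summable (\<lambda>m. z ^ m * b (l + m))" for l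
    by (rule summable_comparison_test'[OF geo, of 0]) (use z single b0 in \<open>auto intro!: mult_left_mono\<close>)
  have g0: "0 \<le> g l" for l unfolding g_def by (intro suminf_nonneg sg) (use z b0 in auto)
  have "(\<Sum>l<L. g l) \<le> (\<Sum>m. z ^ m * B)" for L
  proof -
    have "(\<Sum>l<L. g l) = (\<Sum>m. \<Sum>l<L. z ^ m * b (l + m))"
      unfolding g_def by (rule suminf_sum[symmetric]) (rule sg)
    also have "\<dots> \<le> (\<Sum>m. z ^ m * B)"
      using z partial by (intro suminf_le summable_sum sg geo) (auto simp: sum_distrib_left[symmetric])
    finally show ?thesis .
  qed
  then have "summable g"
    by (intro bounded_imp_summable[where B = "\<Sum>m. z ^ m * B"] g0)
      (auto simp: lessThan_Suc_atMost[symmetric] simp del: sum.lessThan_Suc)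
  then have sumG: "summable (\<lambda>l. G * g l)" by (rule summable_mult)
  have G0: "0 \<le> G" by (simp add: G_def)
  show ?thesis
  proof
    show "ell s (\<lambda>l. (G * g l) powr (1 / t))"
      using sumG g0 G0 finite(2) by (simp add: finite(1) ell_ereal powr_powr)
    fix l n
    let ?S = "\<Sum>m<n. x ^ m * a (l + m)"
    have "?S \<ge> 0" using x a by (intro sum_nonneg) auto
    have "?S powr t \<le> G * (\<Sum>m<n. z ^ m * b (l + m))"
      unfolding z_def G_def b_def using a by (intro geometric_weighted_sum_powr_le x finite)
    also have "\<dots> \<le> G * g l"
      unfolding g_def using z b0 by (intro mult_left_mono sum_le_suminf sg G0) auto
    finally have "(?S powr t) powr (1 / t) \<le> (G * g l) powr (1 / t)"
      using finite by (intro powr_mono2) auto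
    then show "?S \<le> (G * g l) powr (1 / t)"
      using \<open>?S \<ge> 0\<close> finite by (simp add: powr_powr)
  qed
qed

section \<open>Dyadic condensation of Lorentz sequence spaces\<close>

lemma dyadic_block:
  assumes "1 \<le> (n::nat)" obtains l where "2 ^ l \<le> n" "n < 2 ^ Suc l"
  using ex_power_ivl1[of 2 n] assms by auto

lemma sum_dyadic_block: "(\<Sum>n = (2::nat) ^ l..<2 ^ Suc l. c) = 2 ^ l * (c::real)" for l :: nat
  by simp

text \<open>
  Cauchy condensation. The \<open>s\<close>-th power of the factor \<open>n powr (- 1 / s)\<close> is \<open>1 / n\<close>, and a dyadic
  block contains as many indices as its left end point, so the block contributes at most the \<open>s\<close>-th
  power of \<open>h l\<close>. For \<open>s = \<infinity>\<close> the factor is \<open>1\<close>.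
\<close>

lemma ell_condense_intro:
  assumes s: "0 < s" and h: "ell s h"
    and f: "\<And>l n. L \<le> l \<Longrightarrow> 2 ^ l \<le> n \<Longrightarrow> n < 2 ^ Suc l \<Longrightarrow> \<bar>f n\<bar> \<le> \<bar>h l\<bar>"
  shows "ell s (\<lambda>n. real n powr (- real_of_ereal (1 / s)) * f n)"
  using s
proof (cases rule: ell_cases)
  case infinite
  then obtain B where B: "\<And>l. \<bar>h l\<bar> \<le> B"
    using h by (auto simp: ell_infinity bdd_above_def)
  have le: "\<bar>f n\<bar> \<le> B" if n: "2 ^ L \<le> n" for n
  proof -
    obtain l where l: "2 ^ l \<le> n" "n < 2 ^ Suc l"
      using dyadic_block[of n] n by (metis le_trans one_le_numeral one_le_power)
    then have "(2::nat) ^ L < 2 ^ Suc l" using n by linarith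
    then have "L \<le> l" by (simp only: power_strict_increasing_iff)
    then show ?thesis using f[OF _ l] B[of l] by linarith
  qed
  have "ell s (\<lambda>_. B)" unfolding infinite by (rule ell_infinityI[of _ "\<bar>B\<bar>"]) simp
  then show ?thesis
  proof (rule ell_dominated[OF s])
    fix n :: nat assume "2 ^ L \<le> n"
    then have "\<bar>f n\<bar> \<le> \<bar>B\<bar>" using le[of n] by linarith
    then show "\<bar>real n powr (- real_of_ereal (1 / s)) * f n\<bar> \<le> 1 * \<bar>B\<bar>"
      by (simp add: infinite)
  qed
next
  case (finite t)
  let ?F = "\<lambda>n. \<bar>real n powr (- (1 / t)) * f n\<bar> powr t"
  have F: "?F n = \<bar>f n\<bar> powr t / real n" if "n > 0" for n
    using that finite by (simp add: abs_mult powr_mult powr_powr powr_minus_divide powr_divide divide_simps)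
  have sh: "summable (\<lambda>l. \<bar>h l\<bar> powr t)" using h by (simp add: finite ell_ereal)
  have block: "sum ?F {2 ^ l..<2 ^ Suc l} \<le> \<bar>h l\<bar> powr t" if "L \<le> l" for l
  proof -
    have "sum ?F {2 ^ l..<2 ^ Suc l} \<le> (\<Sum>n = (2::nat) ^ l..<2 ^ Suc l. \<bar>h l\<bar> powr t / 2 ^ l)"
    proof (rule sum_mono)
      fix n :: nat assume n: "n \<in> {2 ^ l..<2 ^ Suc l}"
      then have "0 < n" by (auto intro: less_le_trans[of 0 "2 ^ l"])
      have "real (2 ^ l) \<le> real n" using n by (simp only: of_nat_le_iff) simp
      moreover have "\<bar>f n\<bar> powr t \<le> \<bar>h l\<bar> powr t"
        using f[OF that, of n] n finite by (intro powr_mono2) auto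
      ultimately show "?F n \<le> \<bar>h l\<bar> powr t / 2 ^ l"
        unfolding F[OF \<open>0 < n\<close>] by (intro frac_le) auto
    qed
    also have "\<dots> = \<bar>h l\<bar> powr t" by (subst sum_dyadic_block) simp
    finally show ?thesis .
  qed
  have part: "sum ?F {2 ^ L..<2 ^ (L + d)} \<le> (\<Sum>l = L..<L + d. \<bar>h l\<bar> powr t)" for d
  proof (induction d)
    case (Suc d)
    have "{2 ^ L..<2 ^ (L + Suc d)} = {2 ^ L..<2 ^ (L + d)} \<union> {2 ^ (L + d)..<2 ^ Suc (L + d) :: nat}"
      by (subst ivl_disj_un_two) auto
    then have "sum ?F {2 ^ L..<2 ^ (L + Suc d)} =
        sum ?F {2 ^ L..<2 ^ (L + d)} + sum ?F {2 ^ (L + d)..<2 ^ Suc (L + d)}"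
      by (simp only:) (intro sum.union_disjoint, auto)
    then show ?case using Suc block[of "L + d"] by simp
  qed simp
  have "summable (\<lambda>n. if n < 2 ^ L then 0 else ?F n)"
  proof (rule bounded_imp_summable)
    fix N
    have "(\<Sum>n\<le>N. if n < 2 ^ L then 0 else ?F n) = sum ?F {2 ^ L..<Suc N}"
      by (rule sum.mono_neutral_cong_right) auto
    also have "\<dots> \<le> sum ?F {2 ^ L..<2 ^ (L + Suc N)}"
    proof (rule sum_mono2)
      have "Suc N < 2 ^ Suc N" by (rule less_exp)
      also have "\<dots> \<le> 2 ^ (L + Suc N)" by (intro power_increasing) auto
      finally show "{2 ^ L..<Suc N} \<subseteq> {2 ^ L..<2 ^ (L + Suc N)}" by auto
    qed auto
    also note part
    also have "(\<Sum>l = L..<L + Suc N. \<bar>h l\<bar> powr t) \<le> (\<Sum>l. \<bar>h l\<bar> powr t)"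
      by (intro sum_le_suminf sh) auto
    finally show "(\<Sum>n\<le>N. if n < 2 ^ L then 0 else ?F n) \<le> (\<Sum>l. \<bar>h l\<bar> powr t)" .
  qed auto
  then have "summable ?F"
    by (rule summable_comparison_test'[where N = "2 ^ L"]) auto
  with finite(2) show ?thesis by (simp add: finite(1) ell_ereal real_of_ereal_one_divide)
qed

text \<open>
  The converse: the terms of a block dominate those of the condensed sequence up to the factor \<open>2\<close>,
  which arises because \<open>1 / n\<close> may be as small as half its value at the left end point.
\<close>

lemma ell_condense_elim:
  assumes s: "0 < s" and ell: "ell s (\<lambda>n. real n powr (- real_of_ereal (1 / s)) * f n)"
    and f: "\<And>l n. 2 ^ l \<le> n \<Longrightarrow> n < 2 ^ Suc l \<Longrightarrow> \<bar>h l\<bar> \<le> \<bar>f n\<bar>"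
  shows "ell s h"
  using s
proof (cases rule: ell_cases)
  case infinite
  then obtain B where B: "\<And>l. \<bar>real l powr 0 * f l\<bar> \<le> B"
    using ell by (auto simp: ell_infinity bdd_above_def)
  have "\<bar>h l\<bar> \<le> B" for l using f[of l "2 ^ l"] B[of "2 ^ l"] by auto
  then show ?thesis unfolding infinite by (rule ell_infinityI)
next
  case (finite t)
  let ?F = "\<lambda>n. \<bar>real n powr (- (1 / t)) * f n\<bar> powr t"
  have F: "?F n = \<bar>f n\<bar> powr t / real n" if "n > 0" for n
    using that finite by (simp add: abs_mult powr_mult powr_powr powr_minus_divide powr_divide divide_simps)
  have sF: "summable ?F" using ell finite(2) by (simp add: finite(1) ell_ereal real_of_ereal_one_divide)
  have block: "\<bar>h l\<bar> powr t / 2 \<le> sum ?F {2 ^ l..<2 ^ Suc l}" for l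
  proof -
    have "\<bar>h l\<bar> powr t / 2 = (\<Sum>n = (2::nat) ^ l..<2 ^ Suc l. \<bar>h l\<bar> powr t / 2 ^ Suc l)"
      by (subst sum_dyadic_block) simp
    also have "\<dots> \<le> sum ?F {2 ^ l..<2 ^ Suc l}"
    proof (rule sum_mono)
      fix n :: nat assume n: "n \<in> {2 ^ l..<2 ^ Suc l}"
      then have "0 < n" by (auto intro: less_le_trans[of 0 "2 ^ l"])
      have "real n \<le> real (2 ^ Suc l)" using n by (simp only: of_nat_le_iff) simp
      moreover have "\<bar>h l\<bar> powr t \<le> \<bar>f n\<bar> powr t"
        using f[of l n] n finite by (intro powr_mono2) auto
      ultimately show "\<bar>h l\<bar> powr t / 2 ^ Suc l \<le> ?F n"
        unfolding F[OF \<open>0 < n\<close>] using \<open>0 < n\<close> by (intro frac_le) auto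
    qed
    finally show ?thesis .
  qed
  have part: "(\<Sum>l<d. \<bar>h l\<bar> powr t / 2) \<le> sum ?F {1..<2 ^ d}" for d
  proof (induction d)
    case (Suc d)
    have "{1..<2 ^ Suc d} = {1..<2 ^ d} \<union> {2 ^ d..<2 ^ Suc d :: nat}"
      by (subst ivl_disj_un_two) auto
    then have "sum ?F {1..<2 ^ Suc d} = sum ?F {1..<2 ^ d} + sum ?F {2 ^ d..<2 ^ Suc d}"
      by (simp only:) (intro sum.union_disjoint, auto)
    then show ?case using Suc block[of d] by simp
  qed simp
  have "summable (\<lambda>l. \<bar>h l\<bar> powr t / 2)"
  proof (rule bounded_imp_summable)
    fix N
    have "(\<Sum>l\<le>N. \<bar>h l\<bar> powr t / 2) \<le> sum ?F {1..<2 ^ Suc N}"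
      using part[of "Suc N"] by (simp add: lessThan_Suc_atMost)
    also have "\<dots> \<le> suminf ?F" by (intro sum_le_suminf sF) auto
    finally show "(\<Sum>l\<le>N. \<bar>h l\<bar> powr t / 2) \<le> suminf ?F" .
  qed simp
  then have "summable (\<lambda>l. 2 * (\<bar>h l\<bar> powr t / 2))" by (rule summable_mult)
  then show ?thesis by (simp add: finite ell_ereal)
qed

lemma bounded_antimono_nonneg:
  fixes \<xi> :: "nat \<Rightarrow> real"
  assumes "antimono_on {1..} \<xi>" "\<forall>n\<ge>1. 0 \<le> \<xi> n"
  shows "bounded (\<xi> ` {1..})"
  using assms by (intro boundedI[of _ "\<xi> 1"]) (auto simp: monotone_on_def)

lemma summable_on_atLeast_1_iff:
  fixes f :: "nat \<Rightarrow> real"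
  assumes "\<And>n. 1 \<le> n \<Longrightarrow> 0 \<le> f n"
  shows "f summable_on {1..} \<longleftrightarrow> summable f"
proof -
  have "f summable_on {1..} \<longleftrightarrow> (\<lambda>n. if n = 0 then 0 else f n) summable_on UNIV"
    by (rule summable_on_cong_neutral) auto
  also have "\<dots> \<longleftrightarrow> summable (\<lambda>n. if n = 0 then 0 else f n)"
    using assms by (intro summable_on_UNIV_nonneg_real_iff) auto
  also have "\<dots> \<longleftrightarrow> summable f"
    by (intro summable_cong eventually_sequentiallyI[of 1]) simp
  finally show ?thesis .
qed

definition lorentz_weight :: "real \<Rightarrow> real \<Rightarrow> nat \<Rightarrow> real"
  where "lorentz_weight r \<alpha> n = log 2 (real n + 1) powr (- \<alpha>) * real n powr (1 / r)"

lemma lorentz_weight_nonneg: "0 \<le> lorentz_weight r \<alpha> n"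
  by (simp add: lorentz_weight_def)

text \<open>
  The weight \<open>n powr (s / r - 1)\<close> of the definition is the \<open>s\<close>-th power of
  \<open>n powr (1 / r) * n powr (- 1 / s)\<close>, which turns the cases \<open>s < \<infinity>\<close> and \<open>s = \<infinity>\<close> into one.
\<close>

lemma lorentz_iff_ell:
  assumes s: "0 < s"
  shows "\<xi> \<in> lorentz r s \<alpha> \<longleftrightarrow> antimono_on {1..} \<xi> \<and> (\<forall>n\<ge>1. 0 \<le> \<xi> n) \<and>
    ell s (\<lambda>n. real n powr (- real_of_ereal (1 / s)) * (lorentz_weight r \<alpha> n * \<xi> n))"
proof (cases "antimono_on {1..} \<xi> \<and> (\<forall>n\<ge>1. 0 \<le> \<xi> n)")
  case True
  then have nn: "0 \<le> \<xi> n" if "1 \<le> n" for n using that by blast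
  have bdd: "bounded (\<xi> ` {1..})" using True bounded_antimono_nonneg by blast
  show ?thesis using s
  proof (cases rule: ell_cases)
    case infinite
    let ?f = "\<lambda>n. lorentz_weight r \<alpha> n * \<xi> n"
    have "bdd_above (?f ` {1..}) \<longleftrightarrow> bdd_above (range (\<lambda>n. \<bar>real n powr 0 * ?f n\<bar>))"
    proof
      assume "bdd_above (?f ` {1..})"
      then obtain B where B: "\<And>n. 1 \<le> n \<Longrightarrow> ?f n \<le> B" by (auto simp: bdd_above_def)
      have "\<bar>real n powr 0 * ?f n\<bar> \<le> \<bar>B\<bar>" for n
        using B[of n] nn[of n] lorentz_weight_nonneg[of r \<alpha> n] by (cases "n = 0") auto
      then show "bdd_above (range (\<lambda>n. \<bar>real n powr 0 * ?f n\<bar>))" by (intro bdd_aboveI2)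
    next
      assume "bdd_above (range (\<lambda>n. \<bar>real n powr 0 * ?f n\<bar>))"
      then obtain B where B: "\<And>n. \<bar>real n powr 0 * ?f n\<bar> \<le> B" by (auto simp: bdd_above_def)
      have "?f n \<le> B" if "1 \<le> n" for n using B[of n] that by simp
      then show "bdd_above (?f ` {1..})" by (intro bdd_aboveI2) auto
    qed
    then show ?thesis
      using True bdd by (simp add: lorentz_def infinite ell_infinity lorentz_weight_def)
  next
    case (finite t)
    let ?F = "\<lambda>n. log 2 (real n + 1) powr (- \<alpha> * t) * real n powr (t / r - 1) * \<xi> n powr t"
    have eq: "\<bar>real n powr (- (1 / t)) * (lorentz_weight r \<alpha> n * \<xi> n)\<bar> powr t = ?F n" if "1 \<le> n" for n
    proof -
      have "\<bar>real n powr (- (1 / t)) * (lorentz_weight r \<alpha> n * \<xi> n)\<bar> powr t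
          = (real n powr (- (1 / t)) * real n powr (1 / r) * log 2 (real n + 1) powr (- \<alpha>) * \<xi> n) powr t"
        using nn[OF that] by (simp add: lorentz_weight_def ac_simps)
      also have "\<dots> = (real n powr (- (1 / t) + 1 / r)) powr t * (log 2 (real n + 1) powr (- \<alpha>)) powr t * \<xi> n powr t"
        using nn[OF that] by (simp add: powr_mult powr_add[symmetric])
      also have "\<dots> = ?F n"
        using finite(2) by (simp add: powr_powr algebra_simps)
      finally show ?thesis .
    qed
    have "?F summable_on {1..} \<longleftrightarrow> summable ?F"
      by (rule summable_on_atLeast_1_iff) simp
    also have "\<dots> \<longleftrightarrow> summable (\<lambda>n. \<bar>real n powr (- (1 / t)) * (lorentz_weight r \<alpha> n * \<xi> n)\<bar> powr t)"
      using eq by (intro summable_cong eventually_sequentiallyI[of 1]) simp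
    finally show ?thesis
      using True bdd finite(2)
      by (simp add: lorentz_def finite(1) ell_ereal real_of_ereal_one_divide)
  qed
qed (auto simp: lorentz_def)

lemma powr_comparable:
  fixes x y K a :: real
  assumes "0 < x" "1 \<le> K" "x / K \<le> y" "y \<le> K * x"
  shows "y powr a \<le> K powr \<bar>a\<bar> * x powr a"
proof (cases "0 \<le> a")
  case True
  have "0 < y" using assms by (smt (verit) divide_pos_pos)
  then have "y powr a \<le> (K * x) powr a" using assms True by (intro powr_mono2) auto
  then show ?thesis using True by (simp add: powr_mult)
next
  case False
  have "y powr a \<le> (x / K) powr a" using assms False by (intro powr_mono2') auto
  then show ?thesis using False assms by (simp add: powr_divide powr_minus_divide)
qed

text \<open>
  The shift in \<open>n + 1\<close> keeps the logarithm at least \<open>1\<close>, hence comparable to \<open>l + 1\<close> also for \<open>l = 0\<close>.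
\<close>

lemma log_dyadic_bounds:
  assumes "2 ^ l \<le> n" "n < 2 ^ Suc l"
  shows "(real l + 1) / 2 \<le> log 2 (real n + 1)" "log 2 (real n + 1) \<le> real l + 1"
proof -
  have n1: "1 \<le> n" using assms by (metis le_trans one_le_numeral one_le_power)
  have le: "2 ^ l \<le> real n" using assms(1) by (metis of_nat_le_iff of_nat_numeral of_nat_power)
  have lt: "real (Suc n) \<le> real (2 ^ Suc l)" using assms by (simp only: of_nat_le_iff Suc_le_eq)
  have "log 2 (real n + 1) \<le> log 2 (2 ^ Suc l)"
    using lt by (intro log_mono) (auto simp: add.commute)
  also have "\<dots> = real l + 1" by (subst log_nat_power) auto
  finally show "log 2 (real n + 1) \<le> real l + 1" .
  have "real l = log 2 (2 ^ l)" by (subst log_nat_power) auto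
  also have "\<dots> \<le> log 2 (real n + 1)"
  proof (intro log_mono)
    show "2 ^ l \<le> real n + 1" using le by linarith
  qed auto
  finally have "real l \<le> log 2 (real n + 1)" .
  moreover have "1 \<le> log 2 (real n + 1)" using n1 by (simp add: le_log_iff)
  moreover have "(real l + 1) / 2 \<le> x" if "real l \<le> x" "1 \<le> x" for x
    using that by (simp add: divide_le_eq)
  ultimately show "(real l + 1) / 2 \<le> log 2 (real n + 1)" by blast
qed

text \<open>
  Up to a bounded factor this is the weight of the Lorentz space on the dyadic block number \<open>l\<close>.
\<close>

definition dyadic_weight :: "real \<Rightarrow> real \<Rightarrow> nat \<Rightarrow> real"
  where "dyadic_weight r \<alpha> l = (real l + 1) powr (- \<alpha>) * 2 powr (real l / r)"

lemma dyadic_weight_pos: "0 < dyadic_weight r \<alpha> l"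
  by (simp add: dyadic_weight_def)

lemma lorentz_weight_dyadic:
  assumes "2 ^ l \<le> n" "n < 2 ^ Suc l"
  shows "lorentz_weight r \<alpha> n \<le> 2 powr (\<bar>\<alpha>\<bar> + \<bar>1 / r\<bar>) * dyadic_weight r \<alpha> l"
    and "dyadic_weight r \<alpha> l \<le> 2 powr (\<bar>\<alpha>\<bar> + \<bar>1 / r\<bar>) * lorentz_weight r \<alpha> n"
proof -
  have n0: "0 < real n" using assms by (metis le_trans one_le_numeral one_le_power of_nat_0_less_iff less_le_trans zero_less_one)
  have le: "2 ^ l \<le> real n" using assms(1) by (metis of_nat_le_iff of_nat_numeral of_nat_power)
  have "real n \<le> real (2 ^ Suc l)" using assms(2) by (simp only: of_nat_le_iff)
  then have lt: "real n \<le> 2 * 2 ^ l" by simp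
  have le2: "2 ^ l / 2 \<le> real n" "2 ^ l \<le> 2 * real n" "real n / 2 \<le> 2 ^ l"
    using le lt n0 by linarith+
  have pw: "2 powr (real l / r) = (2 ^ l) powr (1 / r)"
    by (simp add: powr_realpow[symmetric] powr_powr)
  note log = log_dyadic_bounds[OF assms]
  have L0: "0 < log 2 (real n + 1)" using n0 by simp
  have "log 2 (real n + 1) powr (- \<alpha>) \<le> 2 powr \<bar>- \<alpha>\<bar> * (real l + 1) powr (- \<alpha>)"
    using log by (intro powr_comparable) auto
  moreover have "real n powr (1 / r) \<le> 2 powr \<bar>1 / r\<bar> * (2 ^ l) powr (1 / r)"
    by (intro powr_comparable le2 lt) auto
  ultimately have "lorentz_weight r \<alpha> n \<le>
      (2 powr \<bar>- \<alpha>\<bar> * (real l + 1) powr (- \<alpha>)) * (2 powr \<bar>1 / r\<bar> * (2 ^ l) powr (1 / r))"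
    unfolding lorentz_weight_def by (intro mult_mono) auto
  then show "lorentz_weight r \<alpha> n \<le> 2 powr (\<bar>\<alpha>\<bar> + \<bar>1 / r\<bar>) * dyadic_weight r \<alpha> l"
    unfolding dyadic_weight_def pw powr_add by (simp add: ac_simps)
  have "(real l + 1) powr (- \<alpha>) \<le> 2 powr \<bar>- \<alpha>\<bar> * log 2 (real n + 1) powr (- \<alpha>)"
    using log L0 by (intro powr_comparable) auto
  moreover have "(2 ^ l) powr (1 / r) \<le> 2 powr \<bar>1 / r\<bar> * real n powr (1 / r)"
    by (intro powr_comparable le2 n0) auto
  ultimately have "dyadic_weight r \<alpha> l \<le>
      (2 powr \<bar>- \<alpha>\<bar> * log 2 (real n + 1) powr (- \<alpha>)) * (2 powr \<bar>1 / r\<bar> * real n powr (1 / r))"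
    unfolding dyadic_weight_def pw by (intro mult_mono) auto
  then show "dyadic_weight r \<alpha> l \<le> 2 powr (\<bar>\<alpha>\<bar> + \<bar>1 / r\<bar>) * lorentz_weight r \<alpha> n"
    unfolding lorentz_weight_def powr_add by (simp add: ac_simps)
qed

text \<open>
  Besides shifts by a constant, this controls how the logarithmic part of the weight varies over
  distant blocks: the loss is polynomial in the distance \<open>c\<close>.
\<close>

lemma dyadic_weight_add:
  "dyadic_weight r \<alpha> (l + c) \<le> (real c + 1) powr \<bar>\<alpha>\<bar> * 2 powr (real c / r) * dyadic_weight r \<alpha> l"
proof -
  have "(real (l + c) + 1) powr (- \<alpha>) \<le> (real c + 1) powr \<bar>- \<alpha>\<bar> * (real l + 1) powr (- \<alpha>)"
  proof (rule powr_comparable)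
    have "(real l + 1) / (real c + 1) \<le> real l + 1" by (simp add: divide_le_eq)
    then show "(real l + 1) / (real c + 1) \<le> real (l + c) + 1" by simp
  qed (auto simp: algebra_simps)
  then have "dyadic_weight r \<alpha> (l + c) \<le>
      ((real c + 1) powr \<bar>- \<alpha>\<bar> * (real l + 1) powr (- \<alpha>)) * 2 powr (real (l + c) / r)"
    unfolding dyadic_weight_def by (intro mult_right_mono) auto
  also have "\<dots> = (real c + 1) powr \<bar>\<alpha>\<bar> * 2 powr (real c / r) * dyadic_weight r \<alpha> l"
    by (simp add: dyadic_weight_def add_divide_distrib powr_add)
  finally show ?thesis .
qed

text \<open>
  Monotonicity bounds a whole block from below by the value at its right end point, whence the
  index shift in the proof.
\<close>

lemma lorentz_imp_ell_dyadic:
  assumes s: "0 < s" and \<xi>: "\<xi> \<in> lorentz r s \<alpha>"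
  shows "ell s (\<lambda>J. dyadic_weight r \<alpha> J * \<xi> (2 ^ J))"
proof -
  define C where "C = 2 powr (\<bar>\<alpha>\<bar> + \<bar>1 / r\<bar>)"
  have C: "0 < C" by (simp add: C_def)
  have anti: "antimono_on {1..} \<xi>" and nn: "\<forall>n\<ge>1. 0 \<le> \<xi> n"
    and ell: "ell s (\<lambda>n. real n powr (- real_of_ereal (1 / s)) * (lorentz_weight r \<alpha> n * \<xi> n))"
    using \<xi> unfolding lorentz_iff_ell[OF s] by auto
  have "ell s (\<lambda>l. dyadic_weight r \<alpha> l * \<xi> (2 ^ Suc l) / C)"
  proof (rule ell_condense_elim[OF s ell])
    fix l n :: nat assume n: "2 ^ l \<le> n" "n < 2 ^ Suc l"
    then have n1: "1 \<le> n" by (metis le_trans one_le_numeral one_le_power)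
    have "\<xi> (2 ^ Suc l) \<le> \<xi> n"
      by (rule monotone_onD[OF anti, simplified]) (use n n1 in auto)
    moreover have nn': "0 \<le> \<xi> (2 ^ Suc l)" using nn by simp
    ultimately have "dyadic_weight r \<alpha> l * \<xi> (2 ^ Suc l) \<le> (C * lorentz_weight r \<alpha> n) * \<xi> n"
      using lorentz_weight_dyadic(2)[OF n, of r \<alpha>] lorentz_weight_nonneg C
      unfolding C_def by (intro mult_mono) auto
    then have "dyadic_weight r \<alpha> l * \<xi> (2 ^ Suc l) / C \<le> lorentz_weight r \<alpha> n * \<xi> n"
      using C by (simp add: field_simps)
    moreover have "0 \<le> dyadic_weight r \<alpha> l * \<xi> (2 ^ Suc l) / C"
      using nn' C dyadic_weight_pos[of r \<alpha> l] by simp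
    ultimately show "\<bar>dyadic_weight r \<alpha> l * \<xi> (2 ^ Suc l) / C\<bar> \<le> \<bar>lorentz_weight r \<alpha> n * \<xi> n\<bar>"
      by linarith
  qed
  then have "ell s (\<lambda>l. dyadic_weight r \<alpha> (l + 1) * \<xi> (2 ^ (l + 1)))"
  proof (rule ell_dominated[OF s, where N = 0])
    fix l
    let ?D = "(real 1 + 1) powr \<bar>\<alpha>\<bar> * 2 powr (real 1 / r)"
    have "0 \<le> \<xi> (2 ^ Suc l)" using nn by simp
    then have "dyadic_weight r \<alpha> (l + 1) * \<xi> (2 ^ Suc l) \<le> ?D * dyadic_weight r \<alpha> l * \<xi> (2 ^ Suc l)"
      by (intro mult_right_mono dyadic_weight_add)
    then show "\<bar>dyadic_weight r \<alpha> (l + 1) * \<xi> (2 ^ (l + 1))\<bar> \<le>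
        (?D * C) * \<bar>dyadic_weight r \<alpha> l * \<xi> (2 ^ Suc l) / C\<bar>"
      using \<open>0 \<le> \<xi> (2 ^ Suc l)\<close> C dyadic_weight_pos[of r \<alpha>] by (simp add: less_imp_le abs_mult)
  qed
  then show ?thesis by (subst (asm) ell_shift_iff[OF s])
qed

text \<open>
  The shift \<open>c\<close> costs only a constant factor in the weight. This is what makes constant factors in
  the index of an entropy number harmless.
\<close>

lemma lorentzI_dyadic:
  assumes s: "0 < s" and anti: "antimono_on {1..} \<xi>" and nn: "\<forall>n\<ge>1. 0 \<le> \<xi> n"
    and ell: "ell s (\<lambda>J. dyadic_weight r \<alpha> J * \<xi> (2 ^ (J + c)))"
  shows "\<xi> \<in> lorentz r s \<alpha>"
proof -
  define C where "C = 2 powr (\<bar>\<alpha>\<bar> + \<bar>1 / r\<bar>) * ((real c + 1) powr \<bar>\<alpha>\<bar> * 2 powr (real c / r))"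
  define h where "h l = C * (dyadic_weight r \<alpha> (l - c) * \<xi> (2 ^ l))" for l
  have "ell s (\<lambda>l. h (l + c))"
    by (rule ell_dominated[OF s ell, of 0 _ "\<bar>C\<bar>"]) (simp add: h_def abs_mult)
  then have h: "ell s h" by (subst (asm) ell_shift_iff[OF s])
  have "ell s (\<lambda>n. real n powr (- real_of_ereal (1 / s)) * (lorentz_weight r \<alpha> n * \<xi> n))"
  proof (rule ell_condense_intro[OF s h])
    fix l n :: nat assume l: "c \<le> l" and n: "2 ^ l \<le> n" "n < 2 ^ Suc l"
    then have n1: "1 \<le> n" by (metis le_trans one_le_numeral one_le_power)
    have \<xi>n: "\<xi> n \<le> \<xi> (2 ^ l)"
      by (rule monotone_onD[OF anti, simplified]) (use n n1 in auto)
    have "lorentz_weight r \<alpha> n \<le> 2 powr (\<bar>\<alpha>\<bar> + \<bar>1 / r\<bar>) * dyadic_weight r \<alpha> (l - c + c)"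
      using lorentz_weight_dyadic(1)[OF n] l by simp
    also have "\<dots> \<le> 2 powr (\<bar>\<alpha>\<bar> + \<bar>1 / r\<bar>) *
        ((real c + 1) powr \<bar>\<alpha>\<bar> * 2 powr (real c / r) * dyadic_weight r \<alpha> (l - c))"
      by (intro mult_left_mono dyadic_weight_add) simp
    finally have "lorentz_weight r \<alpha> n \<le> C * dyadic_weight r \<alpha> (l - c)"
      by (simp add: C_def mult.assoc)
    then have "lorentz_weight r \<alpha> n * \<xi> n \<le> C * dyadic_weight r \<alpha> (l - c) * \<xi> (2 ^ l)"
      using \<xi>n nn n1 dyadic_weight_pos[of r \<alpha>] by (intro mult_mono) (auto simp: C_def less_imp_le)
    moreover have "0 \<le> lorentz_weight r \<alpha> n * \<xi> n" using nn n1 lorentz_weight_nonneg by simp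
    ultimately show "\<bar>lorentz_weight r \<alpha> n * \<xi> n\<bar> \<le> \<bar>h l\<bar>"
      unfolding h_def by (simp add: mult.assoc)
  qed
  then show ?thesis unfolding lorentz_iff_ell[OF s] using anti nn by simp
qed

section \<open>Type and Maurey's empirical method\<close>

lemma rademacher_cases: "rademacher i t = -1 \<or> rademacher i t = 0 \<or> rademacher i t = 1"
  by (auto simp: rademacher_def sgn_if)

text \<open>
  The zeros are dyadic rationals.
\<close>

lemma negligible_rademacher_zeros: "negligible {t. \<exists>i. rademacher i t = 0}"
proof -
  have "{t. \<exists>i. rademacher i t = 0} \<subseteq> (\<lambda>(i, n). real_of_int n / 2 ^ i) ` (UNIV :: (nat \<times> int) set)"
  proof
    fix t assume "t \<in> {t. \<exists>i. rademacher i t = 0}"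
    then obtain i where "sin (2 ^ i * pi * t) = 0" by (auto simp: rademacher_def sgn_0_0)
    then obtain n :: int where "2 ^ i * pi * t = of_int n * pi" by (auto simp: sin_zero_iff_int2)
    then have "t = real_of_int n / 2 ^ i" by (simp add: field_simps)
    then show "t \<in> (\<lambda>(i, n). real_of_int n / 2 ^ i) ` (UNIV :: (nat \<times> int) set)"
      by (intro image_eqI[of _ _ "(i, n)"]) auto
  qed
  then have "countable {t. \<exists>i. rademacher i t = 0}"
    by (rule countable_subset) auto
  then show ?thesis
    by (simp add: negligible_iff_null_sets countable_imp_null_set_lborel null_sets_completionI)
qed

text \<open>
  The vector-valued sum takes finitely many values, so it is a simple function. Simple functions are
  closed under arbitrary operations, whereas addition on a non-separable space need not be measurable.
\<close>

lemma rademacher_sum_integrable: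
  fixes x :: "nat \<Rightarrow> 'a::real_normed_vector"
  shows "(\<lambda>t. norm (\<Sum>i=1..k. rademacher i t *\<^sub>R x i)) integrable_on {0..1}"
proof (rule measurable_bounded_by_integrable_imp_integrable_real)
  let ?M = "lebesgue_on {0..1::real}"
  have r: "simple_function ?M (rademacher i)" for i
  proof (rule simple_function_borel_measurable)
    have "rademacher i \<in> borel_measurable lborel"
      unfolding rademacher_def[abs_def] by measurable
    then show "rademacher i \<in> borel_measurable ?M"
      by (intro measurable_restrict_space1 measurable_completion)
    have "rademacher i ` space ?M \<subseteq> {-1, 0, 1}" using rademacher_cases by blast
    then show "finite (rademacher i ` space ?M)" by (rule finite_subset) simp
  qed
  have "simple_function ?M (\<lambda>t. \<Sum>i\<in>I. rademacher i t *\<^sub>R x i)" if "finite I" for I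
    using that
  proof induction
    case (insert j I)
    have "simple_function ?M (\<lambda>t. rademacher j t *\<^sub>R x j + (\<Sum>i\<in>I. rademacher i t *\<^sub>R x i))"
      by (rule simple_function_compose2[OF r insert.IH, of "\<lambda>c v. c *\<^sub>R x j + v"])
    then show ?case using insert by simp
  qed simp
  then have "simple_function ?M (\<lambda>t. norm (\<Sum>i=1..k. rademacher i t *\<^sub>R x i))"
    by (intro simple_function_compose1[where g = norm]) auto
  then show "(\<lambda>t. norm (\<Sum>i=1..k. rademacher i t *\<^sub>R x i)) \<in> borel_measurable ?M"
    by (rule borel_measurable_simple_function)
  show "(\<lambda>t. \<Sum>i=1..k. norm (x i)) integrable_on {0..1::real}"
    by (rule integrable_const_ivl)
  fix t :: real
  have "norm (\<Sum>i=1..k. rademacher i t *\<^sub>R x i) \<le> (\<Sum>i=1..k. norm (rademacher i t *\<^sub>R x i))"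
    by (rule norm_sum)
  also have "\<dots> \<le> (\<Sum>i=1..k. norm (x i))"
    using rademacher_cases[of _ t] by (intro sum_mono) (metis abs_minus_cancel abs_one abs_zero
        mult_cancel_right1 mult_zero_left norm_ge_zero norm_scaleR order_refl)
  finally show "\<bar>norm (\<Sum>i=1..k. rademacher i t *\<^sub>R x i)\<bar> \<le> (\<Sum>i=1..k. norm (x i))" by simp
qed simp

lemma sum_product_weights:
  fixes w :: "'i \<Rightarrow> real"
  assumes "finite K" and "sum w I = 1"
  shows "(\<Sum>f\<in>K \<rightarrow>\<^sub>E I. \<Prod>l\<in>K. w (f l)) = 1"
  proof -
  have "finite I" using assms(2) sum.infinite[of I w] by fastforce
  then have "(\<Sum>f\<in>K \<rightarrow>\<^sub>E I. \<Prod>l\<in>K. w (f l)) = (\<Prod>l\<in>K. sum w I)"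
    using assms by (intro prod_sum_PiE[symmetric]) auto
  then show ?thesis using assms by simp
qed

text \<open>
  Under the product weights the coordinate \<open>f j\<close> has distribution \<open>w\<close>, so the left-hand side is the
  expectation of \<open>y (f j)\<close>.
\<close>

lemma product_weights_marginal:
  fixes w :: "'i \<Rightarrow> real" and y :: "'i \<Rightarrow> 'a::real_vector"
  assumes K: "finite K" and I: "finite I" and w: "sum w I = 1" and j: "j \<in> K"
  shows "(\<Sum>f\<in>K \<rightarrow>\<^sub>E I. (\<Prod>l\<in>K. w (f l)) *\<^sub>R y (f j)) = (\<Sum>i\<in>I. w i *\<^sub>R y i)"
proof -
  let ?P = "K \<rightarrow>\<^sub>E I"
  have fin: "finite ?P" using K I by (rule finite_PiE)
  have marginal: "(\<Sum>f\<in>?P. if f j = i then \<Prod>l\<in>K. w (f l) else 0) = w i" if i: "i \<in> I" for i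
  proof -
    define u where "u l a = (if l = j \<and> a \<noteq> i then 0 else w a)" for l a
    have "(\<Sum>f\<in>?P. if f j = i then \<Prod>l\<in>K. w (f l) else 0) = (\<Sum>f\<in>?P. \<Prod>l\<in>K. u l (f l))"
    proof (rule sum.cong)
      fix f assume "f \<in> ?P"
      show "(if f j = i then \<Prod>l\<in>K. w (f l) else 0) = (\<Prod>l\<in>K. u l (f l))"
        using K j by (auto simp: u_def intro!: prod.cong prod_zero[symmetric])
    qed simp
    also have "\<dots> = (\<Prod>l\<in>K. \<Sum>a\<in>I. u l a)" using K I by (simp add: prod_sum_PiE)
    also have "\<dots> = (\<Prod>l\<in>K. if l = j then w i else 1)"
    proof (rule prod.cong)
      fix l assume "l \<in> K"
      show "(\<Sum>a\<in>I. u l a) = (if l = j then w i else 1)"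
      proof (cases "l = j")
        case True
        have "(\<Sum>a\<in>I. u l a) = (\<Sum>a\<in>I. if a = i then w a else 0)"
          using True by (intro sum.cong) (auto simp: u_def)
        then show ?thesis using True I i by simp
      qed (use w in \<open>simp add: u_def\<close>)
    qed simp
    also have "\<dots> = w i" using K j by simp
    finally show ?thesis .
  qed
  have "(\<Sum>f\<in>?P. (\<Prod>l\<in>K. w (f l)) *\<^sub>R y (f j)) =
      (\<Sum>f\<in>?P. \<Sum>i\<in>I. (if f j = i then \<Prod>l\<in>K. w (f l) else 0) *\<^sub>R y i)"
  proof (rule sum.cong)
    fix f assume "f \<in> ?P"
    then have "f j \<in> I" using j by auto
    have "(\<Sum>i\<in>I. (if f j = i then \<Prod>l\<in>K. w (f l) else 0) *\<^sub>R y i) =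
        (\<Sum>i\<in>I. if f j = i then (\<Prod>l\<in>K. w (f l)) *\<^sub>R y i else 0)"
      by (intro sum.cong) auto
    then show "(\<Prod>l\<in>K. w (f l)) *\<^sub>R y (f j) =
        (\<Sum>i\<in>I. (if f j = i then \<Prod>l\<in>K. w (f l) else 0) *\<^sub>R y i)"
      using I \<open>f j \<in> I\<close> by simp
  qed simp
  also have "\<dots> = (\<Sum>i\<in>I. (\<Sum>f\<in>?P. if f j = i then \<Prod>l\<in>K. w (f l) else 0) *\<^sub>R y i)"
    by (subst sum.swap) (simp add: scaleR_sum_left)
  also have "\<dots> = (\<Sum>i\<in>I. w i *\<^sub>R y i)"
    by (intro sum.cong) (simp_all add: marginal)
  finally show ?thesis .
qed

text \<open>
  The type constant \<open>\<rho>\<close> is exposed because it enters the covering radii.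
\<close>

definition type_bound :: "'a::banach itself \<Rightarrow> real \<Rightarrow> real \<Rightarrow> bool"
  where "type_bound _ p \<rho> \<longleftrightarrow> (\<forall>k. \<forall>x :: nat \<Rightarrow> 'a.
      integral {0..1} (\<lambda>t. norm (\<Sum>i=1..k. rademacher i t *\<^sub>R x i))
        \<le> \<rho> * (\<Sum>i=1..k. norm (x i) powr p) powr (1 / p))"

text \<open>
  Symmetrisation. Let \<open>f\<close> and \<open>g\<close> be independent samples of size \<open>k\<close>. Exchanging \<open>f l\<close> and \<open>g l\<close> for
  those \<open>l\<close> with \<open>rademacher l t = -1\<close> preserves the joint distribution, so the expectation of the
  norm is the same with or without the signs, for every \<open>t\<close> outside a null set. Integrating over \<open>t\<close>
  and applying the type inequality to each pair of samples gives the bound.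
\<close>

lemma mean_difference_le:
  fixes y :: "'i \<Rightarrow> 'a::banach"
  assumes type: "type_bound TYPE('a) p \<rho>" and p: "0 < p" and \<rho>: "0 < \<rho>"
    and I: "finite I" and w: "\<And>i. i \<in> I \<Longrightarrow> 0 \<le> w i" and w1: "sum w I = 1"
    and y: "\<And>i. i \<in> I \<Longrightarrow> norm (y i) \<le> b" and b: "0 \<le> b"
  shows "(\<Sum>(f, g)\<in>({1..k::nat} \<rightarrow>\<^sub>E I) \<times> ({1..k} \<rightarrow>\<^sub>E I).
      ((\<Prod>l=1..k. w (f l)) * (\<Prod>l=1..k. w (g l))) * norm (\<Sum>l=1..k. y (f l) - y (g l)))
      \<le> \<rho> * (2 * b * real k powr (1 / p))"
proof -
  let ?P = "{1..k} \<rightarrow>\<^sub>E I"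
  define W where "W f = (\<Prod>l=1..k. w (f l))" for f :: "nat \<Rightarrow> 'i"
  define E where "E e = (\<Sum>(f, g)\<in>?P \<times> ?P. (W f * W g) * norm (\<Sum>l=1..k. e l *\<^sub>R (y (f l) - y (g l))))"
    for e :: "nat \<Rightarrow> real"
  have fin: "finite (?P \<times> ?P)" using I by (intro finite_cartesian_product finite_PiE) auto
  have W0: "0 \<le> W f" if "f \<in> ?P" for f
    unfolding W_def using that w by (intro prod_nonneg) (metis PiE_mem)
  have W1: "sum W ?P = 1" unfolding W_def using w1 by (intro sum_product_weights) auto
  have WW1: "(\<Sum>(f, g)\<in>?P \<times> ?P. W f * W g) = 1"
    using W1 by (simp add: sum.cartesian_product[symmetric] sum_product[symmetric])
  have swap: "E e = E (\<lambda>_. 1)" if e: "\<And>l. l \<in> {1..k} \<Longrightarrow> e l = 1 \<or> e l = -1" for e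
  proof -
    define sw where "sw f g l = (if e l = 1 then f l else g l)" for f g :: "nat \<Rightarrow> 'i" and l
    define \<Phi> where "\<Phi> = (\<lambda>(f, g). (sw f g, sw g f))"
    have mem: "sw f g \<in> ?P" if "f \<in> ?P" "g \<in> ?P" for f g
      using that by (auto simp: PiE_iff sw_def extensional_def)
    have \<Phi>: "\<Phi> (f, g) = (sw f g, sw g f)" for f g by (simp add: \<Phi>_def)
    have "sw (sw f g) (sw g f) = f" for f g by (rule ext) (simp add: sw_def)
    then have inv: "\<forall>z\<in>?P \<times> ?P. \<Phi> (\<Phi> z) = z" by (simp add: \<Phi>_def case_prod_beta)
    have "\<Phi> ` (?P \<times> ?P) \<subseteq> ?P \<times> ?P"
    proof (rule image_subsetI)
      fix z assume "z \<in> ?P \<times> ?P"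
      then show "\<Phi> z \<in> ?P \<times> ?P" by (cases z) (simp only: \<Phi> mem mem_Sigma_iff)
    qed
    then have bij: "bij_betw \<Phi> (?P \<times> ?P) (?P \<times> ?P)"
      using inv by (intro bij_betw_byWitness[where f' = \<Phi>])
    have W_sw: "W (sw f g) * W (sw g f) = W f * W g" for f g
      unfolding W_def prod.distrib[symmetric] by (intro prod.cong) (auto simp: sw_def mult.commute)
    have norm_sw: "(\<Sum>l=1..k. e l *\<^sub>R (y (sw f g l) - y (sw g f l))) = (\<Sum>l=1..k. y (f l) - y (g l))" for f g
    proof (rule sum.cong)
      fix l assume "l \<in> {1..k}"
      then have "e l = 1 \<or> e l = -1" by (rule e)
      then show "e l *\<^sub>R (y (sw f g l) - y (sw g f l)) = y (f l) - y (g l)"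
        by (elim disjE) (simp_all add: sw_def)
    qed simp
    define H where "H e' = (\<lambda>(f, g). (W f * W g) * norm (\<Sum>l=1..k. e' l *\<^sub>R (y (f l) - y (g l))))"
      for e' :: "nat \<Rightarrow> real"
    have "H e (\<Phi> z) = H (\<lambda>_. 1) z" for z
      by (cases z) (simp only: H_def \<Phi> prod.case W_sw norm_sw scaleR_one)
    then have "sum (H (\<lambda>_. 1)) (?P \<times> ?P) = (\<Sum>z\<in>?P \<times> ?P. H e (\<Phi> z))" by simp
    also have "\<dots> = sum (H e) (?P \<times> ?P)" by (rule sum.reindex_bij_betw[OF bij])
    finally show ?thesis by (simp only: E_def H_def)
  qed
  have int: "((\<lambda>t. E (\<lambda>l. rademacher l t)) has_integral
      (\<Sum>(f, g)\<in>?P \<times> ?P. (W f * W g) * integral {0..1} (\<lambda>t. norm (\<Sum>l=1..k. rademacher l t *\<^sub>R (y (f l) - y (g l)))))) {0..1}"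
    unfolding E_def case_prod_beta
    by (intro has_integral_sum[OF fin] has_integral_mult_right integrable_integral
        rademacher_sum_integrable)
  have "((\<lambda>t::real. E (\<lambda>_. 1)) has_integral E (\<lambda>_. 1)) {0..1}"
    using has_integral_const_real[of "E (\<lambda>_. 1)" 0 1] by simp
  then have "((\<lambda>t. E (\<lambda>l. rademacher l t)) has_integral E (\<lambda>_. 1)) {0..1}"
  proof (rule has_integral_spike[OF negligible_rademacher_zeros, rotated])
    fix t :: real assume "t \<in> {0..1} - {t. \<exists>i. rademacher i t = 0}"
    then show "E (\<lambda>l. rademacher l t) = E (\<lambda>_. 1)"
      using rademacher_cases[of _ t] by (intro swap) auto
  qed
  with int have "E (\<lambda>_. 1) = (\<Sum>(f, g)\<in>?P \<times> ?P. (W f * W g) *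
      integral {0..1} (\<lambda>t. norm (\<Sum>l=1..k. rademacher l t *\<^sub>R (y (f l) - y (g l)))))"
    by (rule has_integral_unique[symmetric])
  also have "\<dots> \<le> (\<Sum>(f, g)\<in>?P \<times> ?P. (W f * W g) * (\<rho> * (2 * b * real k powr (1 / p))))"
  proof (rule sum_mono, clarify, rule mult_left_mono)
    fix f g assume fg: "f \<in> ?P" "g \<in> ?P"
    show "0 \<le> W f * W g" using fg W0 by simp
    have "norm (y (f l) - y (g l)) \<le> 2 * b" if "l \<in> {1..k}" for l
    proof -
      have "f l \<in> I" "g l \<in> I" using fg that by auto
      then show ?thesis
        using y[of "f l"] y[of "g l"] norm_triangle_ineq4[of "y (f l)" "y (g l)"] by simp
    qed
    then have "(\<Sum>l=1..k. norm (y (f l) - y (g l)) powr p) \<le> (\<Sum>l=1..k. (2 * b) powr p)"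
      using p by (intro sum_mono powr_mono2) auto
    then have "(\<Sum>l=1..k. norm (y (f l) - y (g l)) powr p) powr (1 / p)
        \<le> (real k * (2 * b) powr p) powr (1 / p)"
      using p by (intro powr_mono2) (auto intro: sum_nonneg)
    also have "\<dots> = 2 * b * real k powr (1 / p)"
      using p b by (simp add: powr_mult powr_powr)
    finally show "integral {0..1} (\<lambda>t. norm (\<Sum>l=1..k. rademacher l t *\<^sub>R (y (f l) - y (g l))))
        \<le> \<rho> * (2 * b * real k powr (1 / p))"
      using type \<rho> unfolding type_bound_def
      by (meson order_trans mult_left_mono less_imp_le)
  qed
  also have "\<dots> = \<rho> * (2 * b * real k powr (1 / p))"
    using WW1 by (simp add: case_prod_beta sum_distrib_right[symmetric])
  finally show ?thesis by (simp add: E_def W_def)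
qed

lemma exists_le_weighted_mean:
  fixes W F :: "'i \<Rightarrow> real"
  assumes "finite P" "\<And>f. f \<in> P \<Longrightarrow> 0 \<le> W f" "sum W P = 1" "(\<Sum>f\<in>P. W f * F f) \<le> B"
  shows "\<exists>f\<in>P. F f \<le> B"
proof (rule ccontr)
  assume "\<not> ?thesis"
  then have gt: "B < F f" if "f \<in> P" for f using that by auto
  have "(\<Sum>f\<in>P. W f * (F f - B)) \<le> 0"
    using assms by (simp add: right_diff_distrib sum_subtractf sum_distrib_right[symmetric])
  moreover have nn: "0 \<le> W f * (F f - B)" if "f \<in> P" for f
    using assms(2)[OF that] gt[OF that] by simp
  ultimately have "(\<Sum>f\<in>P. W f * (F f - B)) = 0" by (meson antisym sum_nonneg)
  then have "\<forall>f\<in>P. W f * (F f - B) = 0"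
    using sum_nonneg_eq_0_iff[OF assms(1) nn] by simp
  then have "W f = 0" if "f \<in> P" for f using that gt by fastforce
  then show False using assms(3) by simp
qed

text \<open>
  Maurey's empirical method. Draw \<open>k\<close> points independently with distribution \<open>w\<close>. Their mean equals
  \<open>\<Sum>i\<in>I. w i *\<^sub>R y i\<close>; replacing this mean by the expectation over an independent second sample
  reduces the expected error to the symmetrised situation, and some sample is at most as bad as the
  expectation.
\<close>

lemma maurey_approximation:
  fixes y :: "'i \<Rightarrow> 'a::banach"
  assumes type: "type_bound TYPE('a) p \<rho>" and p: "0 < p" and \<rho>: "0 < \<rho>"
    and I: "finite I" and w: "\<And>i. i \<in> I \<Longrightarrow> 0 \<le> w i" and w1: "sum w I = 1"
    and y: "\<And>i. i \<in> I \<Longrightarrow> norm (y i) \<le> b" and b: "0 \<le> b" and k: "1 \<le> k"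
  shows "\<exists>f\<in>{1..k} \<rightarrow>\<^sub>E I. norm ((\<Sum>i\<in>I. w i *\<^sub>R y i) - (\<Sum>l=1..k. y (f l)) /\<^sub>R real k)
      \<le> 2 * \<rho> * b * real k powr (1 / p - 1)"
proof -
  let ?P = "{1..k} \<rightarrow>\<^sub>E I"
  define W where "W f = (\<Prod>l=1..k. w (f l))" for f :: "nat \<Rightarrow> 'i"
  define x where "x = (\<Sum>i\<in>I. w i *\<^sub>R y i)"
  define Y where "Y f = (\<Sum>l=1..k. y (f l))" for f :: "nat \<Rightarrow> 'i"
  have fin: "finite ?P" using I by (intro finite_PiE) auto
  have W0: "0 \<le> W f" if "f \<in> ?P" for f
    unfolding W_def using that w by (intro prod_nonneg) (metis PiE_mem)
  have W1: "sum W ?P = 1" unfolding W_def using w1 by (intro sum_product_weights) auto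
  have mean: "(\<Sum>g\<in>?P. W g *\<^sub>R Y g) = real k *\<^sub>R x"
  proof -
    have "(\<Sum>g\<in>?P. W g *\<^sub>R Y g) = (\<Sum>l=1..k. \<Sum>g\<in>?P. W g *\<^sub>R y (g l))"
      unfolding Y_def scaleR_sum_right by (rule sum.swap)
    also have "\<dots> = (\<Sum>l=1..k. x)"
      unfolding W_def x_def using I w1 by (intro sum.cong product_weights_marginal) auto
    finally show ?thesis by (simp add: sum_constant_scaleR)
  qed
  have "(\<Sum>f\<in>?P. W f * norm (Y f - real k *\<^sub>R x)) \<le> (\<Sum>f\<in>?P. \<Sum>g\<in>?P. (W f * W g) * norm (Y f - Y g))"
  proof (rule sum_mono)
    fix f assume f: "f \<in> ?P"
    have "Y f - real k *\<^sub>R x = (\<Sum>g\<in>?P. W g *\<^sub>R (Y f - Y g))"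
      using W1 by (simp add: scaleR_diff_right sum_subtractf mean[unfolded One_nat_def] scaleR_sum_left[symmetric])
    also have "norm \<dots> \<le> (\<Sum>g\<in>?P. norm (W g *\<^sub>R (Y f - Y g)))" by (rule norm_sum)
    also have "\<dots> = (\<Sum>g\<in>?P. W g * norm (Y f - Y g))"
      using W0 by (intro sum.cong) auto
    finally have "W f * norm (Y f - real k *\<^sub>R x) \<le> W f * (\<Sum>g\<in>?P. W g * norm (Y f - Y g))"
      using W0[OF f] by (rule mult_left_mono)
    then show "W f * norm (Y f - real k *\<^sub>R x) \<le> (\<Sum>g\<in>?P. (W f * W g) * norm (Y f - Y g))"
      by (simp add: sum_distrib_left mult.assoc)
  qed
  also have "\<dots> = (\<Sum>(f, g)\<in>?P \<times> ?P. (W f * W g) * norm (\<Sum>l=1..k. y (f l) - y (g l)))"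
    by (simp add: sum.cartesian_product Y_def sum_subtractf)
  also have "\<dots> \<le> \<rho> * (2 * b * real k powr (1 / p))"
    unfolding W_def by (rule mean_difference_le[OF type p \<rho> I w w1 y b])
  finally have "\<exists>f\<in>?P. norm (Y f - real k *\<^sub>R x) \<le> \<rho> * (2 * b * real k powr (1 / p))"
    using W0 W1 by (intro exists_le_weighted_mean[where W = W] fin) auto
  then obtain f where f: "f \<in> ?P"
    and le: "norm (Y f - real k *\<^sub>R x) \<le> \<rho> * (2 * b * real k powr (1 / p))" by blast
  have "norm (x - Y f /\<^sub>R real k) = norm (Y f - real k *\<^sub>R x) / real k"
  proof -
    have "x - Y f /\<^sub>R real k = (- (1 / real k)) *\<^sub>R (Y f - real k *\<^sub>R x)"
      using k by (simp add: scaleR_diff_right divide_inverse)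
    then show ?thesis using k by simp
  qed
  also have "\<dots> \<le> \<rho> * (2 * b * real k powr (1 / p)) / real k"
    using le by (rule divide_right_mono) simp
  also have "\<dots> = 2 * \<rho> * b * real k powr (1 / p - 1)"
    using k by (simp add: powr_diff)
  finally show ?thesis using f unfolding x_def Y_def by blast
qed

section \<open>Coverings of absolutely convex hulls\<close>

text \<open>
  The centres form a set of bounded cardinality, so that sums of two coverings need no enumeration.
\<close>

definition covered_by :: "nat \<Rightarrow> real \<Rightarrow> 'a::metric_space set \<Rightarrow> bool"
  where "covered_by N \<epsilon> A \<longleftrightarrow> (\<exists>F. finite F \<and> card F \<le> N \<and> A \<subseteq> (\<Union>x\<in>F. cball x \<epsilon>))"

lemma covered_byI:
  "finite F \<Longrightarrow> card F \<le> N \<Longrightarrow> A \<subseteq> (\<Union>x\<in>F. cball x \<epsilon>) \<Longrightarrow> covered_by N \<epsilon> A"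
  unfolding covered_by_def by blast

lemma covered_by_mono:
  "covered_by N \<epsilon> A \<Longrightarrow> N \<le> M \<Longrightarrow> \<epsilon> \<le> \<delta> \<Longrightarrow> B \<subseteq> A \<Longrightarrow> covered_by M \<delta> B"
  unfolding covered_by_def by (meson UN_mono cball_subset_cball_iff order.trans order.refl subset_cball)

lemma covered_by_plus:
  fixes A B C :: "'a::real_normed_vector set"
  assumes A: "covered_by N \<epsilon> A" and B: "covered_by M \<delta> B"
    and C: "\<And>z. z \<in> C \<Longrightarrow> \<exists>a\<in>A. \<exists>b\<in>B. z = a + b"
  shows "covered_by (N * M) (\<epsilon> + \<delta>) C"
proof -
  obtain F where F: "finite F" "card F \<le> N" "A \<subseteq> (\<Union>x\<in>F. cball x \<epsilon>)"
    using A by (auto simp: covered_by_def)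
  obtain G where G: "finite G" "card G \<le> M" "B \<subseteq> (\<Union>x\<in>G. cball x \<delta>)"
    using B by (auto simp: covered_by_def)
  let ?H = "(\<lambda>(x, y). x + y) ` (F \<times> G)"
  have "card ?H \<le> card (F \<times> G)" using F G by (intro card_image_le) auto
  also have "\<dots> \<le> N * M" using F G by (simp add: card_cartesian_product mult_mono)
  finally have "card ?H \<le> N * M" .
  moreover have "C \<subseteq> (\<Union>x\<in>?H. cball x (\<epsilon> + \<delta>))"
  proof
    fix z assume "z \<in> C"
    then obtain a b where ab: "a \<in> A" "b \<in> B" "z = a + b" using C by blast
    then obtain x y where "x \<in> F" "dist x a \<le> \<epsilon>" "y \<in> G" "dist y b \<le> \<delta>"
      using F(3) G(3) by (force simp: subset_iff)
    moreover have "dist (x + y) (a + b) \<le> dist x a + dist y b" by (rule dist_triangle_add)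
    ultimately show "z \<in> (\<Union>x\<in>?H. cball x (\<epsilon> + \<delta>))"
      by (intro UN_I[of "x + y"]) (auto simp: ab)
  qed
  moreover have "finite ?H" using F G by simp
  ultimately show ?thesis by (intro covered_byI)
qed

lemma covered_by_entropy_number_le:
  assumes "covered_by (2 ^ (n - 1)) \<epsilon> A" "0 \<le> \<epsilon>"
  shows "entropy_number n A \<le> \<epsilon>"
proof -
  obtain F where F: "finite F" "card F \<le> 2 ^ (n - 1)" "A \<subseteq> (\<Union>x\<in>F. cball x \<epsilon>)"
    using assms by (auto simp: covered_by_def)
  obtain x :: "nat \<Rightarrow> 'a" where x: "bij_betw x {1..card F} F"
    using ex_bij_betw_nat_finite_1[OF F(1)] by auto
  have "F \<subseteq> x ` {1..2 ^ (n - 1)}"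
    using x F(2) unfolding bij_betw_def by fastforce
  then have "A \<subseteq> (\<Union>i\<in>{1..2 ^ (n - 1)}. cball (x i) \<epsilon>)"
    using F(3) by fastforce
  then show ?thesis
    unfolding entropy_number_def cover_number_def using assms
    by (intro cInf_lower) (auto intro: bdd_belowI[of _ 0])
qed

lemma cover_number_set_nonempty:
  fixes A :: "'a::metric_space set"
  assumes "bounded A" "1 \<le> n"
  shows "{\<epsilon>. 0 \<le> \<epsilon> \<and> (\<exists>x :: nat \<Rightarrow> 'a. A \<subseteq> (\<Union>i\<in>{1..n}. cball (x i) \<epsilon>))} \<noteq> {}"
proof -
  obtain c e where "A \<subseteq> cball c e" using assms by (auto simp: bounded_subset_cball)
  then have "A \<subseteq> (\<Union>i\<in>{1..n}. cball ((\<lambda>_. c) i) (max e 0))" using assms(2) by fastforce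
  then show ?thesis by (intro ex_in_conv[THEN iffD1] exI[of _ "max e 0"]) (auto intro!: exI[of _ "\<lambda>_. c"])
qed

lemma entropy_number_nonneg:
  assumes "bounded A" shows "0 \<le> entropy_number n A"
  unfolding entropy_number_def cover_number_def
  by (intro cInf_greatest cover_number_set_nonempty assms) auto

lemma entropy_number_antimono:
  assumes "bounded A" "m \<le> n" shows "entropy_number n A \<le> entropy_number m A"
  unfolding entropy_number_def cover_number_def
proof (rule cInf_superset_mono[OF cover_number_set_nonempty])
  have "(2::nat) ^ (m - 1) \<le> 2 ^ (n - 1)" using assms(2) by (intro power_increasing) auto
  then have sub: "{1..2 ^ (m - 1)} \<subseteq> {1..2 ^ (n - 1) :: nat}" by simp
  have "A \<subseteq> (\<Union>i\<in>{1..2 ^ (n - 1)}. cball (x i) \<epsilon>)"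
    if "A \<subseteq> (\<Union>i\<in>{1..2 ^ (m - 1)}. cball (x i) \<epsilon>)" for x :: "nat \<Rightarrow> 'a" and \<epsilon>
    by (rule order_trans[OF that UN_mono[OF sub order.refl]])
  then show "{\<epsilon>. 0 \<le> \<epsilon> \<and> (\<exists>x :: nat \<Rightarrow> 'a. A \<subseteq> (\<Union>i\<in>{1..2 ^ (m - 1)}. cball (x i) \<epsilon>))} \<subseteq>
      {\<epsilon>. 0 \<le> \<epsilon> \<and> (\<exists>x :: nat \<Rightarrow> 'a. A \<subseteq> (\<Union>i\<in>{1..2 ^ (n - 1)}. cball (x i) \<epsilon>))}"
    by (intro Collect_mono) blast
qed (use assms in \<open>auto intro: bdd_belowI[of _ 0]\<close>)

definition abs_hull :: "'i set \<Rightarrow> ('i \<Rightarrow> 'a::real_normed_vector) \<Rightarrow> 'a set"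
  where "abs_hull K v = {\<Sum>k\<in>K. c k *\<^sub>R v k | c. (\<Sum>k\<in>K. \<bar>c k\<bar>) \<le> (1::real)}"

text \<open>
  Every coefficient is rounded down to a multiple of \<open>1 / M\<close>. The error decays like \<open>1 / M\<close> while the
  logarithm of the number of balls grows only like \<open>log M\<close>, which is efficient in low dimensions.
\<close>

lemma covered_by_abs_hull_grid:
  fixes v :: "'i \<Rightarrow> 'a::real_normed_vector"
  assumes K: "finite K" and v: "\<And>k. k \<in> K \<Longrightarrow> norm (v k) \<le> b" and M: "1 \<le> M"
  shows "covered_by ((2 * M + 1) ^ card K) (real (card K) * b / real M) (abs_hull K v)"
proof -
  let ?Z = "{- int M..int M}"
  let ?F = "(\<lambda>z. \<Sum>k\<in>K. (real_of_int (z k) / real M) *\<^sub>R v k) ` (K \<rightarrow>\<^sub>E ?Z)"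
  have fin: "finite (K \<rightarrow>\<^sub>E ?Z)" using K by (intro finite_PiE) auto
  have "card ?F \<le> card (K \<rightarrow>\<^sub>E ?Z)" using fin by (rule card_image_le)
  also have "\<dots> = (2 * M + 1) ^ card K" using K by (simp add: card_PiE nat_add_distrib nat_mult_distrib)
  finally have card: "card ?F \<le> (2 * M + 1) ^ card K" .
  have "abs_hull K v \<subseteq> (\<Union>x\<in>?F. cball x (real (card K) * b / real M))"
  proof
    fix x assume "x \<in> abs_hull K v"
    then obtain c where c: "x = (\<Sum>k\<in>K. c k *\<^sub>R v k)" "(\<Sum>k\<in>K. \<bar>c k\<bar>) \<le> 1"
      by (auto simp: abs_hull_def)
    define z where "z = (\<lambda>k\<in>K. \<lfloor>c k * real M\<rfloor>)"
    have M0: "0 < real M" using M by simp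
    have ck: "\<bar>c k\<bar> \<le> 1" if "k \<in> K" for k
      using member_le_sum[of k K "\<lambda>k. \<bar>c k\<bar>"] that K c(2) by auto
    have "z k \<in> ?Z" if "k \<in> K" for k
    proof -
      have "\<bar>c k * real M\<bar> \<le> 1 * real M"
        unfolding abs_mult using ck[OF that] M0 by (intro mult_mono) auto
      then have "- real M \<le> c k * real M" "c k * real M \<le> real M" by (auto simp: abs_le_iff)
      then show ?thesis using that by (simp add: z_def le_floor_iff floor_le_iff)
    qed
    then have mem: "z \<in> K \<rightarrow>\<^sub>E ?Z" by (auto simp: z_def)
    have err: "\<bar>real_of_int (z k) / real M - c k\<bar> \<le> 1 / real M" if "k \<in> K" for k
    proof -
      have "\<bar>real_of_int (z k) - c k * real M\<bar> \<le> 1"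
        using that by (simp add: z_def) linarith
      then have "\<bar>real_of_int (z k) - c k * real M\<bar> / real M \<le> 1 / real M"
        by (intro divide_right_mono) auto
      moreover have "real_of_int (z k) / real M - c k = (real_of_int (z k) - c k * real M) / real M"
        using M0 by (simp add: field_simps)
      ultimately show ?thesis using M0 by (simp add: abs_divide)
    qed
    have "dist (\<Sum>k\<in>K. (real_of_int (z k) / real M) *\<^sub>R v k) x =
        norm (\<Sum>k\<in>K. (real_of_int (z k) / real M - c k) *\<^sub>R v k)"
      by (simp add: dist_norm c(1) sum_subtractf[symmetric] scaleR_diff_left)
    also have "\<dots> \<le> (\<Sum>k\<in>K. 1 / real M * b)"
      by (intro sum_norm_le) (simp only: norm_scaleR real_norm_def, intro mult_mono err v, auto)
    finally have "x \<in> cball (\<Sum>k\<in>K. (real_of_int (z k) / real M) *\<^sub>R v k) (real (card K) * b / real M)"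
      by simp
    then show "x \<in> (\<Union>x\<in>?F. cball x (real (card K) * b / real M))" by (rule UN_I[OF imageI[OF mem]])
  qed
  then show ?thesis by (intro covered_byI[OF finite_imageI[OF fin] card])
qed

text \<open>
  The absolutely convex hull is the convex hull of the signed points \<open>v k\<close> and \<open>- v k\<close>; every point is
  approximated by the mean of a list of \<open>k\<close> of them, and the number of such lists counts the balls.
\<close>

lemma covered_by_abs_hull_maurey:
  fixes v :: "'i \<Rightarrow> 'a::banach"
  assumes type: "type_bound TYPE('a) p \<rho>" and p: "0 < p" and \<rho>: "0 < \<rho>"
    and K: "finite K" "K \<noteq> {}" and v: "\<And>i. i \<in> K \<Longrightarrow> norm (v i) \<le> b" and b: "0 \<le> b" and k: "1 \<le> k"
  shows "covered_by ((2 * card K) ^ k) (2 * \<rho> * b * real k powr (1 / p - 1)) (abs_hull K v)"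
proof -
  let ?I = "K \<times> {1, -1 :: real}"
  define y where "y = (\<lambda>(i, e). e *\<^sub>R v i)"
  let ?F = "(\<lambda>f. (\<Sum>l=1..k. y (f l)) /\<^sub>R real k) ` ({1..k} \<rightarrow>\<^sub>E ?I)"
  have fin: "finite ({1..k} \<rightarrow>\<^sub>E ?I)" using K by (intro finite_PiE) auto
  have "card ?F \<le> card ({1..k} \<rightarrow>\<^sub>E ?I)" using fin by (rule card_image_le)
  also have "\<dots> = card ?I ^ k" by (simp add: card_PiE)
  also have "card ?I = 2 * card K" by (simp add: card_cartesian_product)
  finally have card: "card ?F \<le> (2 * card K) ^ k" .
  have y: "norm (y i) \<le> b" if "i \<in> ?I" for i
    using that v by (auto simp: y_def)
  have "abs_hull K v \<subseteq> (\<Union>x\<in>?F. cball x (2 * \<rho> * b * real k powr (1 / p - 1)))"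
  proof
    fix x assume "x \<in> abs_hull K v"
    then obtain c where c: "x = (\<Sum>k\<in>K. c k *\<^sub>R v k)" "(\<Sum>k\<in>K. \<bar>c k\<bar>) \<le> 1"
      by (auto simp: abs_hull_def)
    \<comment> \<open>The missing mass is spread evenly over all signed points, where it cancels.\<close>
    define d where "d = (1 - (\<Sum>k\<in>K. \<bar>c k\<bar>)) / (2 * real (card K))"
    have d: "0 \<le> d" using c(2) by (simp add: d_def)
    define w where "w = (\<lambda>(i, e). (\<bar>c i\<bar> + e * c i) / 2 + d)"
    have w0: "0 \<le> w i" if "i \<in> ?I" for i
      using that d by (auto simp: w_def abs_if)
    have "sum w ?I = (\<Sum>i\<in>K. \<Sum>e\<in>{1, -1}. w (i, e))"
      unfolding sum.cartesian_product by (intro sum.cong) auto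
    also have "\<dots> = (\<Sum>i\<in>K. \<bar>c i\<bar> + 2 * d)" by (intro sum.cong) (auto simp: w_def field_simps)
    also have "\<dots> = (\<Sum>k\<in>K. \<bar>c k\<bar>) + 2 * real (card K) * d" by (simp add: sum.distrib)
    also have "\<dots> = 1" using K by (simp add: d_def)
    finally have w1: "sum w ?I = 1" .
    have "(\<Sum>i\<in>?I. w i *\<^sub>R y i) = (\<Sum>i\<in>K. \<Sum>e\<in>{1, -1}. w (i, e) *\<^sub>R y (i, e))"

      unfolding sum.cartesian_product by (intro sum.cong) auto
    also have "\<dots> = (\<Sum>i\<in>K. c i *\<^sub>R v i)"
    proof (rule sum.cong)
      fix i
      have "(\<Sum>e\<in>{1, -1}. w (i, e) *\<^sub>R y (i, e)) = (w (i, 1) - w (i, -1)) *\<^sub>R v i"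
        by (simp add: y_def scaleR_diff_left)
      also have "w (i, 1) - w (i, -1) = c i" by (simp add: w_def field_simps)
      finally show "(\<Sum>e\<in>{1, -1}. w (i, e) *\<^sub>R y (i, e)) = c i *\<^sub>R v i" .
    qed simp
    finally have x: "(\<Sum>i\<in>?I. w i *\<^sub>R y i) = x" using c by simp
    have "finite ?I" using K by simp
    then have "\<exists>f\<in>{1..k} \<rightarrow>\<^sub>E ?I. norm ((\<Sum>i\<in>?I. w i *\<^sub>R y i) - (\<Sum>l=1..k. y (f l)) /\<^sub>R real k)
        \<le> 2 * \<rho> * b * real k powr (1 / p - 1)"
      by (rule maurey_approximation[OF type p \<rho> _ w0 w1 y b k])
    then obtain f where f: "f \<in> {1..k} \<rightarrow>\<^sub>E ?I"
      and le: "norm (x - (\<Sum>l=1..k. y (f l)) /\<^sub>R real k) \<le> 2 * \<rho> * b * real k powr (1 / p - 1)"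
      unfolding x by (rule bexE)
    from f show "x \<in> (\<Union>x\<in>?F. cball x (2 * \<rho> * b * real k powr (1 / p - 1)))"
      by (rule UN_I[OF imageI]) (use le in \<open>simp add: dist_norm norm_minus_commute\<close>)
  qed
  then show ?thesis by (intro covered_byI[OF finite_imageI[OF fin] card])
qed

lemma abs_hull_union:
  assumes "finite K" "finite L" "K \<inter> L = {}" "z \<in> abs_hull (K \<union> L) v"
  shows "\<exists>a\<in>abs_hull K v. \<exists>b\<in>abs_hull L v. z = a + b"
proof -
  obtain c where c: "z = (\<Sum>k\<in>K \<union> L. c k *\<^sub>R v k)" "(\<Sum>k\<in>K \<union> L. \<bar>c k\<bar>) \<le> 1"
    using assms(4) by (auto simp: abs_hull_def)
  have nn: "0 \<le> (\<Sum>k\<in>A. \<bar>c k\<bar>)" for A by (intro sum_nonneg abs_ge_zero)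
  have "(\<Sum>k\<in>K. \<bar>c k\<bar>) \<le> 1" "(\<Sum>k\<in>L. \<bar>c k\<bar>) \<le> 1"
    using c(2) nn[of K] nn[of L] unfolding sum.union_disjoint[OF assms(1-3)] by linarith+
  moreover have "z = (\<Sum>k\<in>K. c k *\<^sub>R v k) + (\<Sum>k\<in>L. c k *\<^sub>R v k)"
    unfolding c(1) by (rule sum.union_disjoint[OF assms(1-3)])
  ultimately show ?thesis unfolding abs_hull_def by blast
qed

text \<open>
  The cardinalities of the coverings multiply and the radii add up when a block is appended.
\<close>

lemma covered_by_abs_hull_blocks:
  fixes v :: "nat \<Rightarrow> 'a::banach" and m :: "nat \<Rightarrow> nat"
  assumes type: "type_bound TYPE('a) p \<rho>" and p: "0 < p" and \<rho>: "0 < \<rho>"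
    and m: "strict_mono m" and "m0 \<le> m i"
    and start: "covered_by N \<epsilon> (abs_hull {m0..<m i} v)"
    and v: "\<And>j l. m j \<le> l \<Longrightarrow> norm (v l) \<le> b j" and k: "\<And>j. 1 \<le> k j"
  shows "covered_by (N * (\<Prod>j=i..<i + d. (2 * m (Suc j)) ^ k j))
      (\<epsilon> + (\<Sum>j=i..<i + d. 2 * \<rho> * b j * real (k j) powr (1 / p - 1))) (abs_hull {m0..<m (i + d)} v)"
proof (induction d)
  case (Suc d)
  let ?j = "i + d"
  have lt: "m ?j < m (Suc ?j)" using m by (simp add: strict_mono_def)
  have le: "m0 \<le> m ?j" using \<open>m0 \<le> m i\<close> strict_mono_mono[OF m, THEN monoD, of i ?j] by simp
  have "0 \<le> b ?j" using v[of ?j "m ?j"] by (meson norm_ge_zero order.trans order.refl)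
  then have "covered_by ((2 * card {m ?j..<m (Suc ?j)}) ^ k ?j) (2 * \<rho> * b ?j * real (k ?j) powr (1 / p - 1))
      (abs_hull {m ?j..<m (Suc ?j)} v)"
    using lt v k by (intro covered_by_abs_hull_maurey type p \<rho>) auto
  then have block: "covered_by ((2 * m (Suc ?j)) ^ k ?j) (2 * \<rho> * b ?j * real (k ?j) powr (1 / p - 1))
      (abs_hull {m ?j..<m (Suc ?j)} v)"
    by (rule covered_by_mono) (auto intro!: power_mono)
  have split: "{m0..<m (i + Suc d)} = {m0..<m ?j} \<union> {m ?j..<m (Suc ?j)}"
    using lt le by (subst ivl_disj_un_two) auto
  have "covered_by (N * (\<Prod>j=i..<i + d. (2 * m (Suc j)) ^ k j) * (2 * m (Suc ?j)) ^ k ?j)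
      (\<epsilon> + (\<Sum>j=i..<i + d. 2 * \<rho> * b j * real (k j) powr (1 / p - 1)) +
        2 * \<rho> * b ?j * real (k ?j) powr (1 / p - 1)) (abs_hull {m0..<m (i + Suc d)} v)"
    unfolding split by (rule covered_by_plus[OF Suc.IH block], rule abs_hull_union) auto
  then show ?case by (simp add: mult.assoc add.assoc)
qed (use start in simp)

section \<open>Entropy numbers of diagonal operators followed by operators from l1\<close>

lift_definition unit_l1 :: "nat \<Rightarrow> l1" is "\<lambda>k n. if n = k \<and> 0 < n then 1 else 0"
proof (intro conjI)
  fix k :: nat
  show "summable (\<lambda>n. \<bar>if n = k \<and> 0 < n then 1 else 0 :: real\<bar>)"
    by (rule summable_finite[of "{k}"]) auto
qed simp

lemma norm_unit_l1_le: "norm (unit_l1 k) \<le> 1"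
proof -
  have "norm (unit_l1 k) = (\<Sum>n\<in>{k}. \<bar>l1_nth (unit_l1 k) n\<bar>)"
    unfolding norm_l1.rep_eq by (rule suminf_finite) (auto simp: unit_l1.rep_eq)
  then show ?thesis by (simp add: unit_l1.rep_eq)
qed

lemma l1_nth_sum: "finite A \<Longrightarrow> l1_nth (\<Sum>a\<in>A. f a) n = (\<Sum>a\<in>A. l1_nth (f a) n)"
  by (induction A rule: finite_induct) (simp_all add: zero_l1.rep_eq plus_l1.rep_eq)

lemma l1_nth_truncation_error:
  "l1_nth (x - (\<Sum>k=1..<m. l1_nth x k *\<^sub>R unit_l1 k)) n = (if n < m then 0 else l1_nth x n)"
proof -
  have "l1_nth (\<Sum>k=1..<m. l1_nth x k *\<^sub>R unit_l1 k) n = (\<Sum>k=1..<m. if k = n then l1_nth x k else 0)"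
    unfolding l1_nth_sum[OF finite_atLeastLessThan]
    by (intro sum.cong) (auto simp: scaleR_l1.rep_eq unit_l1.rep_eq)
  also have "\<dots> = (if 1 \<le> n \<and> n < m then l1_nth x n else 0)" by simp
  finally show ?thesis by (cases "n = 0") (auto simp: minus_l1.rep_eq)
qed

text \<open>
  The coordinates from \<open>m\<close> on are shrunk by the factor \<open>\<sigma> m\<close>, so they contribute only a small ball.
\<close>

lemma diag_op_image_decomposition:
  fixes S :: "l1 \<Rightarrow> 'a::banach"
  assumes S: "bounded_linear S" "\<And>x. norm (S x) \<le> B * norm x" and B: "0 \<le> B"
    and \<sigma>: "antimono_on {1..} \<sigma>" "\<forall>n\<ge>1. 0 \<le> \<sigma> n" and m: "1 \<le> m"
    and z: "z \<in> (S \<circ> diag_op \<sigma>) ` cball 0 1"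
  shows "\<exists>a\<in>abs_hull {1..<m} (\<lambda>k. \<sigma> k *\<^sub>R S (unit_l1 k)). \<exists>b\<in>cball 0 (B * \<sigma> m). z = a + b"
proof -
  interpret S: bounded_linear S by fact
  note nth = l1_nth_diag_op[OF \<sigma>]
  obtain x where x: "norm x \<le> 1" and zx: "z = S (diag_op \<sigma> x)" using z by auto
  define h where "h = (\<Sum>k=1..<m. l1_nth (diag_op \<sigma> x) k *\<^sub>R unit_l1 k)"
  define e where "e = diag_op \<sigma> x - h"
  have "S h = (\<Sum>k=1..<m. l1_nth x k *\<^sub>R \<sigma> k *\<^sub>R S (unit_l1 k))"
    unfolding h_def S.sum by (intro sum.cong) (simp_all add: nth S.scaleR mult.commute)
  moreover have "(\<Sum>k=1..<m. \<bar>l1_nth x k\<bar>) \<le> (\<Sum>k<m. \<bar>l1_nth x k\<bar>)"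
    by (intro sum_mono2) auto
  then have "(\<Sum>k=1..<m. \<bar>l1_nth x k\<bar>) \<le> 1" using sum_abs_le_norm_l1[of x m] x by linarith
  ultimately have hull: "S h \<in> abs_hull {1..<m} (\<lambda>k. \<sigma> k *\<^sub>R S (unit_l1 k))"
    unfolding abs_hull_def by blast
  have e_eq: "l1_nth e n = (if n < m then 0 else \<sigma> n * l1_nth x n)" for n
    unfolding e_def h_def l1_nth_truncation_error by (simp add: nth)
  have e_nth: "\<bar>l1_nth e n\<bar> \<le> \<sigma> m * \<bar>l1_nth x n\<bar>" for n
  proof (cases "n < m")
    case False
    then have "\<sigma> n \<le> \<sigma> m" "0 \<le> \<sigma> n" using \<sigma> m by (auto simp: monotone_on_def)
    then show ?thesis using False by (simp add: e_eq abs_mult mult_right_mono)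
  next
    case True
    then show ?thesis using \<sigma> m by (simp add: e_eq)
  qed
  have "norm e \<le> (\<Sum>n. \<sigma> m * \<bar>l1_nth x n\<bar>)"
    unfolding norm_l1.rep_eq by (intro suminf_le e_nth summable_abs_l1_nth summable_mult)
  also have "\<dots> = \<sigma> m * norm x"
    by (simp add: norm_l1.rep_eq suminf_mult[OF summable_abs_l1_nth])
  also have "\<dots> \<le> \<sigma> m" using x \<sigma> m by (intro mult_left_le) auto
  finally have "B * norm e \<le> B * \<sigma> m" using B by (rule mult_left_mono)
  then have "S e \<in> cball 0 (B * \<sigma> m)" using S(2)[of e] by simp
  moreover have "z = S h + S e" by (simp add: zx e_def S.diff)
  ultimately show ?thesis using hull by blast
qed

lemma covered_by_cball: "covered_by 1 \<epsilon> (cball x \<epsilon>)"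
  unfolding covered_by_def by (intro exI[of _ "{x}"]) auto

text \<open>
  On the block from \<open>block_start j\<close> to \<open>block_start (Suc j)\<close> the logarithm of the coordinate is of
  order \<open>2 ^ j\<close>. The exponent is \<open>2 ^ j - 1\<close> because the hypotheses concern \<open>\<sigma> (2 ^ (n - 1))\<close>, here at
  \<open>n = 2 ^ j\<close>. The first block starts at coordinate \<open>1\<close>.
\<close>

definition block_start :: "nat \<Rightarrow> nat" where "block_start j = 2 ^ (2 ^ j - 1)"

lemma block_start_pos: "1 \<le> block_start j" by (simp add: block_start_def)

lemma strict_mono_block_start: "strict_mono block_start"
  unfolding block_start_def strict_mono_Suc_iff
  by (auto intro!: power_strict_increasing diff_less_mono)

lemma two_times_block_start: "2 * block_start j = 2 ^ 2 ^ j"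
  unfolding block_start_def by (simp add: power_Suc[symmetric] del: power_Suc)

text \<open>
  The coordinates before \<open>block_start i\<close> are rounded to a grid of mesh \<open>2 ^ - q\<close>, block number \<open>j\<close> is
  approximated by means of about \<open>2 ^ (J - j) * \<theta> j\<close> points, and the coordinates from \<open>block_start J\<close>
  on are dropped. Choosing one point of block \<open>j\<close> costs \<open>2 ^ Suc j\<close> bits, so that block costs about
  \<open>2 ^ Suc J * \<theta> j\<close> bits, and the rounding up of the numbers of points adds at most \<open>2 ^ Suc J\<close> bits
  altogether. The free weights \<open>\<theta>\<close> distribute the available bits among the blocks.
\<close>

lemma entropy_number_diag_le:
  fixes S :: "l1 \<Rightarrow> 'a::banach" and \<theta> :: "nat \<Rightarrow> real"
  assumes type: "type_bound TYPE('a) p \<rho>" and p: "1 < p" and \<rho>: "0 < \<rho>"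
    and S: "bounded_linear S" "\<And>x. norm (S x) \<le> B * norm x" and B: "0 \<le> B"
    and \<sigma>: "antimono_on {1..} \<sigma>" "\<forall>n\<ge>1. 0 \<le> \<sigma> n"
    and iJ: "i \<le> J" and \<theta>: "\<And>j. 0 < \<theta> j" "(\<Sum>j=i..<J. \<theta> j) \<le> C"
    and n: "real ((q + 2) * (block_start i - 1)) + (C + 1) * 2 ^ Suc J \<le> real (n - 1)"
  shows "op_entropy_number n (S \<circ> diag_op \<sigma>) \<le>
      real (block_start i - 1) * (B * \<sigma> 1) / 2 ^ q
      + 2 * \<rho> * B * (\<Sum>j=i..<J. \<sigma> (block_start j) * (2 ^ (J - j) * \<theta> j) powr (1 / p - 1))
      + B * \<sigma> (block_start J)"
proof -
  define v where "v k = \<sigma> k *\<^sub>R S (unit_l1 k)" for k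
  define k where "k j = nat \<lceil>2 ^ (J - j) * \<theta> j\<rceil>" for j
  have k1: "1 \<le> k j" for j using \<theta>(1)[of j] by (simp add: k_def Suc_le_eq)
  have k_ge: "2 ^ (J - j) * \<theta> j \<le> real (k j)" for j
    using \<theta>(1)[of j] unfolding k_def by linarith
  have k_le: "real (k j) \<le> 2 ^ (J - j) * \<theta> j + 1" for j
    using \<theta>(1)[of j] unfolding k_def by (simp add: less_imp_le)
  have unit: "norm (S (unit_l1 l)) \<le> B" for l
    using S(2)[of "unit_l1 l"] norm_unit_l1_le[of l] B by (meson mult_left_le order.trans)
  have v: "norm (v l) \<le> B * \<sigma> m" if "1 \<le> m" "m \<le> l" for l m
  proof -
    have "0 \<le> \<sigma> l" "\<sigma> l \<le> \<sigma> m" using \<sigma> that by (auto simp: monotone_on_def)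
    then show ?thesis unfolding v_def using unit[of l] by (simp add: mult.commute[of B] mult_mono)
  qed
  have grid: "covered_by ((2 * 2 ^ q + 1) ^ (block_start i - 1))
      (real (block_start i - 1) * (B * \<sigma> 1) / 2 ^ q) (abs_hull {1..<block_start i} v)"
    using covered_by_abs_hull_grid[of "{1..<block_start i}" v "B * \<sigma> 1" "2 ^ q"] v[of 1] by simp
  have blocks: "covered_by
      ((2 * 2 ^ q + 1) ^ (block_start i - 1) * (\<Prod>j=i..<i + (J - i). (2 * block_start (Suc j)) ^ k j))
      (real (block_start i - 1) * (B * \<sigma> 1) / 2 ^ q +
        (\<Sum>j=i..<i + (J - i). 2 * \<rho> * (B * \<sigma> (block_start j)) * real (k j) powr (1 / p - 1)))
      (abs_hull {1..<block_start (i + (J - i))} v)"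
    using p by (intro covered_by_abs_hull_blocks type \<rho> strict_mono_block_start block_start_pos grid k1 v) auto
  have cover: "covered_by
      ((2 * 2 ^ q + 1) ^ (block_start i - 1) * (\<Prod>j=i..<J. (2 * block_start (Suc j)) ^ k j) * 1)
      (real (block_start i - 1) * (B * \<sigma> 1) / 2 ^ q +
        (\<Sum>j=i..<J. 2 * \<rho> * (B * \<sigma> (block_start j)) * real (k j) powr (1 / p - 1)) + B * \<sigma> (block_start J))
      ((S \<circ> diag_op \<sigma>) ` cball 0 1)"
  proof (rule covered_by_plus[OF _ covered_by_cball[of _ 0]])
    show "covered_by ((2 * 2 ^ q + 1) ^ (block_start i - 1) * (\<Prod>j=i..<J. (2 * block_start (Suc j)) ^ k j))
      (real (block_start i - 1) * (B * \<sigma> 1) / 2 ^ q +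
        (\<Sum>j=i..<J. 2 * \<rho> * (B * \<sigma> (block_start j)) * real (k j) powr (1 / p - 1)))
      (abs_hull {1..<block_start J} v)"
      using blocks iJ by simp
  qed (use diag_op_image_decomposition[OF S B \<sigma> block_start_pos] in \<open>auto simp: v_def[abs_def]\<close>)
  have bits: "(q + 2) * (block_start i - 1) + (\<Sum>j=i..<J. 2 ^ Suc j * k j) \<le> n - 1"
  proof -
    have "real (\<Sum>j=i..<J. 2 ^ Suc j * k j) \<le> (\<Sum>j=i..<J. 2 ^ Suc J * \<theta> j + 2 ^ Suc j)"
    proof (unfold of_nat_sum, rule sum_mono)
      fix j assume "j \<in> {i..<J}"
      then have "2 ^ Suc j * (2 ^ (J - j) * \<theta> j + 1) = 2 ^ Suc J * \<theta> j + 2 ^ Suc j"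
        by (simp add: distrib_left power_add[symmetric] mult.assoc[symmetric])
      then show "real (2 ^ Suc j * k j) \<le> 2 ^ Suc J * \<theta> j + 2 ^ Suc j"
        using mult_left_mono[OF k_le[of j], of "2 ^ Suc j"] by simp
    qed
    also have "\<dots> = 2 ^ Suc J * (\<Sum>j=i..<J. \<theta> j) + (\<Sum>j=i..<J. 2 ^ Suc j)"
      by (simp add: sum.distrib sum_distrib_left)
    also have "\<dots> \<le> 2 ^ Suc J * C + 2 ^ Suc J"
    proof (intro add_mono mult_left_mono \<theta>(2))
      have "(\<Sum>j=i..<J. 2 ^ Suc j :: real) \<le> (\<Sum>j<J. 2 ^ Suc j)" by (intro sum_mono2) auto
      also have "\<dots> = 2 * (\<Sum>j<J. 2 ^ j)" by (simp add: sum_distrib_left)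
      also have "\<dots> = 2 * (2 ^ J - 1)" by (simp add: geometric_sum)
      finally show "(\<Sum>j=i..<J. 2 ^ Suc j :: real) \<le> 2 ^ Suc J" by simp
    qed simp
    finally have "real ((q + 2) * (block_start i - 1) + (\<Sum>j=i..<J. 2 ^ Suc j * k j)) \<le> real (n - 1)"
      using n by (simp add: algebra_simps)
    then show ?thesis by (simp only: of_nat_le_iff)
  qed
  have "(2 * 2 ^ q + 1) ^ (block_start i - 1) \<le> ((2::nat) ^ (q + 2)) ^ (block_start i - 1)"
    by (intro power_mono) auto
  then have "(2 * 2 ^ q + 1) ^ (block_start i - 1) * (\<Prod>j=i..<J. (2 * block_start (Suc j)) ^ k j) * 1
      \<le> ((2::nat) ^ (q + 2)) ^ (block_start i - 1) * (\<Prod>j=i..<J. (2 ^ 2 ^ Suc j) ^ k j)"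
    unfolding two_times_block_start by simp
  also have "\<dots> = 2 ^ ((q + 2) * (block_start i - 1) + (\<Sum>j=i..<J. 2 ^ Suc j * k j))"
    by (simp only: power_add power_mult power_sum)
  also have "\<dots> \<le> 2 ^ (n - 1)" using bits by (intro power_increasing) auto
  finally have cover': "covered_by (2 ^ (n - 1))
      (real (block_start i - 1) * (B * \<sigma> 1) / 2 ^ q
      + 2 * \<rho> * B * (\<Sum>j=i..<J. \<sigma> (block_start j) * (2 ^ (J - j) * \<theta> j) powr (1 / p - 1))
      + B * \<sigma> (block_start J)) ((S \<circ> diag_op \<sigma>) ` cball 0 1)"
  proof (rule covered_by_mono[OF cover])
    have "2 * \<rho> * (B * \<sigma> (block_start j)) * real (k j) powr (1 / p - 1)
        \<le> 2 * \<rho> * B * (\<sigma> (block_start j) * (2 ^ (J - j) * \<theta> j) powr (1 / p - 1))" for j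
    proof -
      have "real (k j) powr (1 / p - 1) \<le> (2 ^ (J - j) * \<theta> j) powr (1 / p - 1)"
        using k_ge \<theta>(1) p by (intro powr_mono2') auto
      then have "2 * \<rho> * (B * \<sigma> (block_start j)) * real (k j) powr (1 / p - 1)
          \<le> 2 * \<rho> * (B * \<sigma> (block_start j)) * (2 ^ (J - j) * \<theta> j) powr (1 / p - 1)"
        using \<rho> B \<sigma>(2) block_start_pos by (intro mult_left_mono) auto
      then show ?thesis by (simp add: mult.assoc)
    qed
    then show "real (block_start i - 1) * (B * \<sigma> 1) / 2 ^ q +
        (\<Sum>j=i..<J. 2 * \<rho> * (B * \<sigma> (block_start j)) * real (k j) powr (1 / p - 1)) + B * \<sigma> (block_start J)
        \<le> real (block_start i - 1) * (B * \<sigma> 1) / 2 ^ q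
      + 2 * \<rho> * B * (\<Sum>j=i..<J. \<sigma> (block_start j) * (2 ^ (J - j) * \<theta> j) powr (1 / p - 1))
      + B * \<sigma> (block_start J)"
      by (auto simp: sum_distrib_left intro!: sum_mono)
  qed simp
  then show ?thesis
    unfolding op_entropy_number_def
    using \<rho> B \<sigma>(2) block_start_pos
    by (intro covered_by_entropy_number_le) (auto intro!: add_nonneg_nonneg mult_nonneg_nonneg sum_nonneg)
qed

lemma bounded_diag_op_image:
  assumes "bounded_linear S" "antimono_on {1..} \<sigma>" "\<forall>n\<ge>1. 0 \<le> \<sigma> n"
  shows "bounded ((S \<circ> diag_op \<sigma>) ` cball 0 1)"
proof -
  have "bounded_linear (S \<circ> diag_op \<sigma>)"
    unfolding o_def by (rule bounded_linear_compose[OF assms(1) bounded_linear_diag_op[OF assms(2,3)]])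
  then show ?thesis by (intro bounded_linear_image bounded_cball)
qed

section \<open>Lorentz space estimates\<close>

lemma polynomial_le_exponential:
  fixes b u :: real
  assumes b: "0 \<le> b" and u: "1 < u"
  obtains C where "0 < C" "\<And>m::nat. (real m + 1) powr b \<le> C * u ^ m"
proof -
  define d where "d = min 1 (ln u / (b + 1))"
  have d: "0 < d" "d \<le> 1" "d * b \<le> ln u"
  proof -
    show "0 < d" using b u by (simp add: d_def)
    have "d \<le> ln u / (b + 1)" by (simp add: d_def)
    then have "d * (b + 1) \<le> ln u" using b by (simp add: pos_le_divide_eq)
    then show "d * b \<le> ln u" using \<open>0 < d\<close> by (simp add: distrib_left)
  qed (simp add: d_def)
  have "(real m + 1) powr b \<le> (1 / d) powr b * u ^ m" for m
  proof -
    have "d * (real m + 1) \<le> 1 + d * real m" using d by (simp add: distrib_left)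
    also have "\<dots> \<le> exp (d * real m)" by (rule exp_ge_add_one_self)
    finally have "real m + 1 \<le> (1 / d) * exp (d * real m)"
      using d by (simp add: field_simps)
    then have "(real m + 1) powr b \<le> ((1 / d) * exp (d * real m)) powr b"
      using b by (intro powr_mono2) auto
    also have "\<dots> = (1 / d) powr b * exp (d * b * real m)"
      by (subst powr_mult) (simp add: exp_powr_real ac_simps)
    also have "exp (d * b * real m) \<le> exp (ln u * real m)"
      using d by (simp add: mult_right_mono)
    also have "exp (ln u * real m) = u ^ m"
      using u by (simp add: exp_of_nat2_mult)
    finally show ?thesis by (simp add: mult_left_mono)
  qed
  moreover have "0 < (1 / d) powr b" using d by simp
  ultimately show ?thesis using that by blast
qed

lemma real_of_ereal_inverse_nonneg: "0 < s \<Longrightarrow> 0 \<le> real_of_ereal (1 / s)"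
  by (cases rule: ell_cases[of s]) (auto simp: real_of_ereal_one_divide)

lemma two_powr_neg_less_one: "0 < x \<Longrightarrow> 2 powr (- x) < (1::real)"
  using powr_less_mono[of "- x" 0 2] by simp

lemma two_powr_power: "(2 powr x) ^ m = 2 powr (x * real m)" for x :: real
  by (simp add: powr_realpow[symmetric] powr_powr)

text \<open>
  A substitute for \<open>J + 1 \<le> 2 * sqrt (2 ^ J)\<close> in natural numbers; it bounds the number of bits per
  coordinate in the grid.
\<close>

lemma Suc_le_two_power_half: "J + 1 \<le> 2 ^ (J div 2 + 1)"
proof (induction J rule: less_induct)
  case (less J)
  show ?case
  proof (cases "J < 2")
    case True
    then show ?thesis by (cases J) auto
  next
    case False
    then have I: "J = Suc (Suc (J - 2))" by simp
    then obtain I where I: "J = Suc (Suc I)" ..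
    have "I + 1 \<le> 2 ^ (I div 2 + 1)" using less[of I] I by simp
    then have "I + 1 \<le> 2 * 2 ^ (I div 2)" by simp
    moreover have "(1::nat) \<le> 2 ^ (I div 2)" by (rule one_le_power) simp
    ultimately have "J + 1 \<le> 4 * 2 ^ (I div 2)" unfolding I by linarith
    moreover have "J div 2 = Suc (I div 2)" using I by simp
    ultimately show ?thesis by simp
  qed
qed

locale type_diagonal =
  fixes p p' \<rho> B :: real and S :: "l1 \<Rightarrow> 'a::banach" and \<sigma> :: "nat \<Rightarrow> real"
  assumes p: "1 < p" and conjugate: "1 / p + 1 / p' = 1"
    and type: "type_bound TYPE('a) p \<rho>" and \<rho>: "0 < \<rho>"
    and S: "bounded_linear S" and S_le: "\<And>x. norm (S x) \<le> B * norm x" and B: "0 \<le> B"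
    and \<sigma>_antimono: "antimono_on {1..} \<sigma>" and \<sigma>_nonneg: "\<forall>n\<ge>1. 0 \<le> \<sigma> n"
begin

definition e :: "nat \<Rightarrow> real" where "e n = op_entropy_number n (S \<circ> diag_op \<sigma>)"

definition \<tau> :: "nat \<Rightarrow> real" where "\<tau> j = \<sigma> (block_start j)"

lemma \<tau>_nonneg: "0 \<le> \<tau> j"
  using \<sigma>_nonneg block_start_pos by (simp add: \<tau>_def)

lemma p'_pos: "0 < p'"
proof -
  have "1 / p < 1" using p by simp
  then have "0 < 1 / p'" using conjugate by linarith
  then show ?thesis by simp
qed

lemma e_nonneg: "0 \<le> e n"
  unfolding e_def op_entropy_number_def
  by (intro entropy_number_nonneg bounded_diag_op_image S \<sigma>_antimono \<sigma>_nonneg)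

lemma e_antimono: "antimono_on {1..} e"
  unfolding e_def op_entropy_number_def
  by (intro monotone_onI entropy_number_antimono bounded_diag_op_image S \<sigma>_antimono \<sigma>_nonneg)

lemma lorentz_eI:
  assumes "0 < s" "ell s (\<lambda>J. dyadic_weight r \<alpha> J * e (2 ^ (J + c)))"
  shows "e \<in> lorentz r s \<alpha>"
  using assms e_antimono e_nonneg by (intro lorentzI_dyadic) auto

lemma ell_\<tau>:
  assumes "0 < s" "(\<lambda>n. \<sigma> (2 ^ (n - 1))) \<in> lorentz r s \<beta>"
  shows "ell s (\<lambda>j. dyadic_weight r \<beta> j * \<tau> j)"
  using lorentz_imp_ell_dyadic[OF assms] by (simp add: \<tau>_def block_start_def)

lemma e_le:
  assumes "i \<le> J" and "\<And>j. 0 < \<theta> j" "(\<Sum>j=i..<J. \<theta> j) \<le> C"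
    and "real ((q + 2) * (block_start i - 1)) + (C + 1) * 2 ^ Suc J \<le> real (2 ^ (J + c) - 1)"
  shows "e (2 ^ (J + c)) \<le> real (block_start i - 1) * (B * \<sigma> 1) / 2 ^ q
      + 2 * \<rho> * B * (\<Sum>j=i..<J. \<tau> j * (2 ^ (J - j) * \<theta> j) powr (- (1 / p'))) + B * \<tau> J"
proof -
  have "1 / p - 1 = - (1 / p')" using conjugate by simp
  then show ?thesis
    unfolding e_def \<tau>_def
    using entropy_number_diag_le[OF type p \<rho> S S_le B \<sigma>_antimono \<sigma>_nonneg assms] by simp
qed

text \<open>
  For \<open>r > p'\<close> the errors of the last blocks dominate. All blocks from the first one on are treated
  by sampling, and the share of the bits decays geometrically with the distance \<open>J - j\<close> from the last
  block. The error of block \<open>j\<close> then carries the factor \<open>x1 ^ (J - j)\<close>, which beats the growth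
  \<open>2 powr ((J - j) / r)\<close> of the Lorentz weight since \<open>1 / r < 1 / p'\<close>.
\<close>

lemma lorentz_above:
  assumes r: "p' < r" and s: "0 < s" and hyp: "(\<lambda>n. \<sigma> (2 ^ (n - 1))) \<in> lorentz r s \<beta>"
  shows "e \<in> lorentz r s \<beta>"
proof -
  define \<mu> where "\<mu> = 1 / p'"
  define g where "g = \<mu> - 1 / r"
  have \<mu>: "0 < \<mu>" using p'_pos by (simp add: \<mu>_def)
  have g: "0 < g" "g < \<mu>" using r p'_pos by (simp_all add: g_def \<mu>_def frac_less2)
  \<comment> \<open>The gap \<open>g\<close> is shared: a quarter pays for the decaying bit shares, a quarter for the logarithmic
    factor (see \<open>u\<close> below), and half of it remains as decay rate \<open>x\<close>.\<close>
  define \<epsilon> where "\<epsilon> = g / (4 * \<mu>)"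
  have \<epsilon>: "0 < \<epsilon>" using g \<mu> by (simp add: \<epsilon>_def)
  define y where "y = 2 powr (- \<epsilon>)"
  have y: "0 < y" "y < 1" using two_powr_neg_less_one[OF \<epsilon>] by (auto simp: y_def)
  define x1 where "x1 = 2 powr (- ((1 - \<epsilon>) * \<mu>))"
  have x1: "0 < x1" by (simp add: x1_def)
  define C where "C = 1 / (1 - y)"
  obtain c :: nat where c: "(C + 1) * 2 + 1 < 2 ^ c"
    using real_arch_pow[of 2 "(C + 1) * 2 + 1"] by auto
  define K where "K = 2 * \<rho> * B + B"
  have K: "0 \<le> K" "2 * \<rho> * B \<le> K" "B \<le> K" using \<rho> B by (simp_all add: K_def)
  have e_bound: "e (2 ^ (J + c)) \<le> K * (\<Sum>m\<le>J. x1 ^ m * \<tau> (J - m))" for J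
  proof -
    define \<theta> where "\<theta> j = y ^ (J - j)" for j
    have "(\<Sum>j=0..<J. \<theta> j) \<le> (\<Sum>j<J. y ^ (J - Suc j))"
      unfolding \<theta>_def atLeast0LessThan using y by (intro sum_mono power_decreasing) auto
    also have "\<dots> = (\<Sum>m<J. y ^ m)" by (rule sum.nat_diff_reindex)
    also have "\<dots> \<le> C" unfolding C_def using y by (rule geometric_partial_sum_le)
    finally have \<theta>: "(\<Sum>j=0..<J. \<theta> j) \<le> C" .
    have "(C + 1) * 2 ^ Suc J \<le> (2 ^ c - 1) * 2 ^ J"
      using c by (simp add: mult.assoc[symmetric])
    also have "\<dots> \<le> 2 ^ (J + c) - 1" by (simp add: power_add algebra_simps)
    finally have "real ((0 + 2) * (block_start 0 - 1)) + (C + 1) * 2 ^ Suc J \<le> real (2 ^ (J + c) - 1)"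
      by (simp add: block_start_def of_nat_diff)
    then have "e (2 ^ (J + c)) \<le> real (block_start 0 - 1) * (B * \<sigma> 1) / 2 ^ 0
      + 2 * \<rho> * B * (\<Sum>j=0..<J. \<tau> j * (2 ^ (J - j) * \<theta> j) powr (- (1 / p'))) + B * \<tau> J"
      using y \<theta> by (intro e_le) (auto simp: \<theta>_def)
    also have "(\<Sum>j=0..<J. \<tau> j * (2 ^ (J - j) * \<theta> j) powr (- (1 / p'))) = (\<Sum>j=0..<J. \<tau> j * x1 ^ (J - j))"
    proof (intro sum.cong arg_cong2[where f = "(*)"] refl)
      fix j
      have "2 ^ (J - j) * \<theta> j = 2 powr ((1 - \<epsilon>) * real (J - j))"
        by (simp add: \<theta>_def y_def two_powr_power powr_realpow[symmetric] powr_add[symmetric] algebra_simps)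
      then show "(2 ^ (J - j) * \<theta> j) powr (- (1 / p')) = x1 ^ (J - j)"
        by (simp only: x1_def two_powr_power powr_powr \<mu>_def[symmetric]) (simp add: algebra_simps)
    qed
    also have "real (block_start 0 - 1) * (B * \<sigma> 1) / 2 ^ 0 = 0" by (simp add: block_start_def)
    also have "0 + 2 * \<rho> * B * (\<Sum>j=0..<J. \<tau> j * x1 ^ (J - j)) + B * \<tau> J
        = 2 * \<rho> * B * (\<Sum>j=0..<J. \<tau> j * x1 ^ (J - j)) + B * \<tau> J" by simp
    also have "\<dots> \<le> K * (\<Sum>j=0..<J. \<tau> j * x1 ^ (J - j)) + K * \<tau> J"
      using K \<tau>_nonneg x1 by (intro add_mono mult_right_mono sum_nonneg mult_nonneg_nonneg) auto
    also have "\<dots> = K * (\<Sum>j\<le>J. \<tau> j * x1 ^ (J - j))"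
      by (simp add: distrib_left atLeast0LessThan lessThan_Suc_atMost[symmetric])
    also have "(\<Sum>j\<le>J. \<tau> j * x1 ^ (J - j)) = (\<Sum>m\<le>J. x1 ^ m * \<tau> (J - m))"
      by (rule sum.reindex_bij_witness[of _ "\<lambda>m. J - m" "\<lambda>j. J - j"]) auto
    finally show ?thesis .
  qed
  define u where "u = 2 powr (g / 4)"
  have u: "1 < u" using g by (simp add: u_def)
  obtain M where M: "0 < M" "\<And>m::nat. (real m + 1) powr \<bar>\<beta>\<bar> \<le> M * u ^ m"
    using polynomial_le_exponential[OF abs_ge_zero u] by blast
  define x where "x = 2 powr (- (g / 2))"
  have x: "0 < x" "x < 1" using two_powr_neg_less_one[of "g / 2"] g by (auto simp: x_def)
  have "(1 - \<epsilon>) * \<mu> = \<mu> - g / 4" using \<mu> by (simp add: \<epsilon>_def field_simps)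
  moreover have "- z + 1 / r + g / 4 = - (g / 2)" if "z = \<mu> - g / 4" for z
    using that g_def by linarith
  ultimately have "- ((1 - \<epsilon>) * \<mu>) + 1 / r + g / 4 = - (g / 2)" by blast
  then have x_eq: "x1 * 2 powr (1 / r) * u = x"
    unfolding x1_def u_def x_def powr_add[symmetric] by simp
  define a where "a j = dyadic_weight r \<beta> j * \<tau> j" for j
  have a0: "0 \<le> a j" for j
    using \<tau>_nonneg dyadic_weight_pos[of r \<beta> j] by (simp add: a_def)
  have term_le: "dyadic_weight r \<beta> J * (x1 ^ m * \<tau> (J - m)) \<le> M * (x ^ m * a (J - m))" if "m \<le> J" for J m
  proof -
    have "dyadic_weight r \<beta> J \<le> (real m + 1) powr \<bar>\<beta>\<bar> * 2 powr (real m / r) * dyadic_weight r \<beta> (J - m)"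
      using dyadic_weight_add[of r \<beta> "J - m" m] that by simp
    also have "\<dots> \<le> (M * u ^ m) * 2 powr (real m / r) * dyadic_weight r \<beta> (J - m)"
      using M dyadic_weight_pos[of r \<beta>] by (intro mult_right_mono) (auto simp: less_imp_le)
    also have "2 powr (real m / r) = (2 powr (1 / r)) ^ m" by (simp add: two_powr_power)
    finally have "dyadic_weight r \<beta> J * (x1 ^ m * \<tau> (J - m))
        \<le> (M * u ^ m) * (2 powr (1 / r)) ^ m * dyadic_weight r \<beta> (J - m) * (x1 ^ m * \<tau> (J - m))"
      using \<tau>_nonneg x1 by (intro mult_right_mono) auto
    also have "\<dots> = M * (x ^ m * a (J - m))"
      unfolding x_eq[symmetric] a_def by (simp add: power_mult_distrib)
    finally show ?thesis .
  qed
  have "ell s (\<lambda>J. dyadic_weight r \<beta> J * e (2 ^ (J + c)))"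
  proof (rule ell_dominated[OF s ell_geometric_head[of s x a, OF s x a0], where N = 0])
    show "ell s a" unfolding a_def by (rule ell_\<tau>[OF s hyp])
    fix J
    have "dyadic_weight r \<beta> J * e (2 ^ (J + c)) \<le> dyadic_weight r \<beta> J * (K * (\<Sum>m\<le>J. x1 ^ m * \<tau> (J - m)))"
      using e_bound dyadic_weight_pos[of r \<beta> J] by (intro mult_left_mono) auto
    also have "\<dots> = K * (\<Sum>m\<le>J. dyadic_weight r \<beta> J * (x1 ^ m * \<tau> (J - m)))"
      by (simp add: sum_distrib_left ac_simps)
    also have "\<dots> \<le> K * (\<Sum>m\<le>J. M * (x ^ m * a (J - m)))"
      using K term_le by (intro mult_left_mono sum_mono) auto
    also have "\<dots> = (K * M) * (\<Sum>m\<le>J. x ^ m * a (J - m))"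
      by (simp add: sum_distrib_left[symmetric] mult.assoc)
    finally show "\<bar>dyadic_weight r \<beta> J * e (2 ^ (J + c))\<bar> \<le> (K * M) * \<bar>\<Sum>m\<le>J. x ^ m * a (J - m)\<bar>"
      using e_nonneg dyadic_weight_pos[of r \<beta> J] x a0 by (simp add: abs_mult sum_nonneg abs_of_nonneg less_imp_le)
  qed
  then show ?thesis by (rule lorentz_eI[OF s])
qed

text \<open>
  For \<open>r < p'\<close> the errors of the first blocks dominate, so sampling starts only at the block \<open>i\<close> with
  \<open>2 ^ i\<close> of order \<open>J\<close>, and the share of the bits decays with the distance \<open>j - i\<close>. The preceding
  coordinates number at most about \<open>2 ^ (J / 2)\<close>, so they can be rounded to a grid whose error is an
  arbitrarily high negative power of \<open>2 ^ J\<close>. The resulting bound depends on \<open>J\<close> through \<open>i\<close> only,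
  apart from the factor \<open>2 powr (- J / p')\<close>; this is the source of the power of the logarithm in the
  target space, and summation over all \<open>J\<close> with the same \<open>i\<close> produces the summand \<open>1 / s\<close> in its
  exponent.
\<close>

lemma lorentz_below:
  assumes r: "0 < r" "r < p'" and s: "0 < s" and hyp: "(\<lambda>n. \<sigma> (2 ^ (n - 1))) \<in> lorentz r s 0"
  shows "e \<in> lorentz p' s (real_of_ereal (1 / s) + 1 / p' - 1 / r)"
proof -
  define \<mu> where "\<mu> = 1 / p'"
  define \<kappa> where "\<kappa> = 1 / r"
  define g where "g = \<kappa> - \<mu>"
  define \<omega> where "\<omega> = real_of_ereal (1 / s)"
  have \<omega>: "0 \<le> \<omega>" using real_of_ereal_inverse_nonneg[OF s] by (simp add: \<omega>_def)
  have \<mu>: "0 < \<mu>" using p'_pos by (simp add: \<mu>_def)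
  have g: "0 < g" using r p'_pos by (simp add: g_def \<mu>_def \<kappa>_def frac_less2)
  define \<epsilon> where "\<epsilon> = g / (2 * \<mu>)"
  have \<epsilon>: "0 < \<epsilon>" "\<epsilon> * \<mu> = g / 2" using g \<mu> by (simp_all add: \<epsilon>_def)
  define y where "y = 2 powr (- \<epsilon>)"
  have y: "0 < y" "y < 1" using two_powr_neg_less_one[OF \<epsilon>(1)] by (auto simp: y_def)
  define x where "x = 2 powr (- (g / 2))"
  have x: "0 < x" "x < 1" using two_powr_neg_less_one[of "g / 2"] g by (auto simp: x_def)
  define C where "C = 1 / (1 - y)"
  \<comment> \<open>With mesh \<open>2 ^ - (Q * J)\<close> the grid error is negligible after multiplication with all weights.\<close>
  obtain Q :: nat where Q: "\<kappa> + 2 \<le> real Q" using real_arch_simple by blast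
  define D where "D = 2 * (real Q + 2) + (C + 1) * 2 + 1"
  obtain c :: nat where c: "D < 2 ^ c"
    using real_arch_pow[of 2 D] by auto
  define K where "K = 2 * \<rho> * B + B"
  have K: "0 \<le> K" "2 * \<rho> * B \<le> K" "B \<le> K" using \<rho> B by (simp_all add: K_def)
  define a where "a j = dyadic_weight r 0 j * \<tau> j" for j
  have a_eq: "a j = 2 powr (\<kappa> * real j) * \<tau> j" for j
    by (simp add: a_def dyadic_weight_def \<kappa>_def)
  have a0: "0 \<le> a j" for j using \<tau>_nonneg by (simp add: a_eq)
  have ell_a: "ell s a" unfolding a_def by (rule ell_\<tau>[OF s hyp])
  obtain h where h: "ell s h" and h_ge: "\<And>i n. (\<Sum>m<n. x ^ m * a (i + m)) \<le> h i"
    by (rule ell_geometric_tail[of s x a, OF s x a0 ell_a]) (rule that)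
  define A where "A = B * \<sigma> 1"
  have A: "0 \<le> A" using B \<sigma>_nonneg by (simp add: A_def)

  have e_bound: "2 powr (\<mu> * real J) * e (2 ^ (J + c)) \<le> A * 2 powr (- (g * real i)) * (1 / 2) ^ i
      + K * 2 powr (- (g * real i)) * h i"
    if i: "2 ^ Suc i \<le> J + 2" for i J
  proof -
    have "Suc i < 2 ^ Suc i" by (rule less_exp)
    then have iJ: "i \<le> J" using i by linarith
    define \<theta> where "\<theta> j = y ^ (j - i)" for j
    have "(\<Sum>j=i..<J. \<theta> j) = (\<Sum>m<J - i. y ^ m)"
      unfolding \<theta>_def by (rule sum.reindex_bij_witness[of _ "\<lambda>m. m + i" "\<lambda>j. j - i"]) auto
    also have "\<dots> \<le> C" unfolding C_def using y by (rule geometric_partial_sum_le)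
    finally have \<theta>: "(\<Sum>j=i..<J. \<theta> j) \<le> C" .
    have "2 ^ i - 1 \<le> J div 2" using i by simp
    then have start: "block_start i \<le> 2 ^ (J div 2)" unfolding block_start_def by (intro power_increasing) auto
    have "(Q * J + 2) * (block_start i - 1) \<le> ((Q + 2) * (J + 1)) * 2 ^ (J div 2)"
      using start by (intro mult_mono) (auto simp: algebra_simps)
    also have "\<dots> \<le> ((Q + 2) * 2 ^ (J div 2 + 1)) * 2 ^ (J div 2)"
      by (intro mult_right_mono mult_left_mono Suc_le_two_power_half) auto
    also have "\<dots> = 2 * (Q + 2) * 2 ^ (2 * (J div 2))" by (simp add: power_add mult_2 algebra_simps)
    also have "\<dots> \<le> 2 * (Q + 2) * 2 ^ J" by (intro mult_left_mono power_increasing) auto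
    finally have "real ((Q * J + 2) * (block_start i - 1)) \<le> real (2 * (Q + 2) * 2 ^ J)"
      by (simp only: of_nat_le_iff)
    then have "real ((Q * J + 2) * (block_start i - 1)) + (C + 1) * 2 ^ Suc J \<le> (D - 1) * 2 ^ J"
      by (simp add: D_def algebra_simps)
    also have "\<dots> \<le> (2 ^ c - 1) * 2 ^ J" using c by (intro mult_right_mono) auto
    also have "\<dots> \<le> 2 ^ (J + c) - 1" by (simp add: power_add algebra_simps)
    finally have "real ((Q * J + 2) * (block_start i - 1)) + (C + 1) * 2 ^ Suc J \<le> real (2 ^ (J + c) - 1)"
      by (simp add: of_nat_diff)
    then have e_J: "e (2 ^ (J + c)) \<le> real (block_start i - 1) * A / 2 ^ (Q * J)
      + 2 * \<rho> * B * (\<Sum>j=i..<J. \<tau> j * (2 ^ (J - j) * \<theta> j) powr (- (1 / p'))) + B * \<tau> J"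
      using y \<theta> iJ unfolding A_def by (intro e_le) (auto simp: \<theta>_def)
    have grid_error: "2 powr (\<mu> * real J) * (real (block_start i - 1) * A / 2 ^ (Q * J))
        \<le> A * 2 powr (- (g * real i)) * (1 / 2) ^ i"
    proof -
      have "block_start i - 1 \<le> 2 ^ J"
        using start power_increasing[of "J div 2" J "2::nat"] by linarith
      then have "real (block_start i - 1) \<le> real (2 ^ J)" by (simp only: of_nat_le_iff)
      then have "real (block_start i - 1) \<le> 2 ^ J" by simp
      then have "2 powr (\<mu> * real J) * (real (block_start i - 1) * A / 2 ^ (Q * J))
          \<le> 2 powr (\<mu> * real J) * (2 ^ J * A / 2 ^ (Q * J))"
        using A by (intro mult_left_mono divide_right_mono mult_right_mono) auto
      also have "\<dots> = A * 2 powr (\<mu> * real J + real J - real Q * real J)"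
        by (simp add: powr_add powr_diff powr_realpow[symmetric])
      also have "\<dots> \<le> A * 2 powr (- (g * real i) - real i)"
      proof (intro mult_left_mono powr_mono A)
        have "(\<kappa> + 2) * real J \<le> real Q * real J" using Q by (intro mult_right_mono) auto
        moreover have "g * real i \<le> g * real J" using g iJ by (intro mult_left_mono) auto
        moreover have "real i \<le> real J" using iJ by simp
        ultimately show "\<mu> * real J + real J - real Q * real J \<le> - (g * real i) - real i"
          by (simp add: g_def algebra_simps)
      qed auto
      also have "\<dots> = A * 2 powr (- (g * real i)) * (1 / 2) ^ i"
        by (simp add: powr_diff powr_realpow power_divide)
      finally show ?thesis .
    qed
    have split_power: "2 powr (- (g * real i) + (- (g / 2) * (real j - real i) + \<kappa> * real j)) * \<tau> j
        = 2 powr (- (g * real i)) * (x ^ (j - i) * a j)" if "i \<le> j" for j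
      by (simp only: powr_add x_def a_eq two_powr_power of_nat_diff[OF that] mult.assoc)
    have block_errors: "(\<Sum>j=i..<J. 2 powr (\<mu> * real J) * (\<tau> j * (2 ^ (J - j) * \<theta> j) powr (- (1 / p'))))
        = 2 powr (- (g * real i)) * (\<Sum>j=i..<J. x ^ (j - i) * a j)"
      unfolding sum_distrib_left
    proof (rule sum.cong)
      fix j assume j: "j \<in> {i..<J}"
      have "2 ^ (J - j) * \<theta> j = 2 powr (real J - real j - \<epsilon> * (real j - real i))"
        using j by (simp add: \<theta>_def y_def two_powr_power powr_realpow[symmetric] powr_add[symmetric] of_nat_diff)
      then have "(2 ^ (J - j) * \<theta> j) powr (- (1 / p')) = 2 powr ((real J - real j - \<epsilon> * (real j - real i)) * - \<mu>)"
        by (simp only: powr_powr \<mu>_def)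
      then have "2 powr (\<mu> * real J) * (\<tau> j * (2 ^ (J - j) * \<theta> j) powr (- (1 / p')))
          = 2 powr (\<mu> * real J + (real J - real j - \<epsilon> * (real j - real i)) * - \<mu>) * \<tau> j"
        by (simp only: powr_add mult.assoc mult.commute[of "\<tau> j"])
      also have "\<mu> * real J + (real J - real j - \<epsilon> * (real j - real i)) * - \<mu>
          = (\<epsilon> * \<mu>) * (real j - real i) + \<mu> * real j"
        by (simp add: algebra_simps)
      also have "\<dots> = - (g * real i) + (- (g / 2) * (real j - real i) + \<kappa> * real j)"
        unfolding \<epsilon>(2) by (simp add: g_def field_simps)
      also have "2 powr \<dots> * \<tau> j = 2 powr (- (g * real i)) * (x ^ (j - i) * a j)"
        using j by (intro split_power) simp
      finally show "2 powr (\<mu> * real J) * (\<tau> j * (2 ^ (J - j) * \<theta> j) powr (- (1 / p')))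
          = 2 powr (- (g * real i)) * (x ^ (j - i) * a j)" .
    qed simp
    have tail_error: "2 powr (\<mu> * real J) * \<tau> J \<le> 2 powr (- (g * real i)) * (x ^ (J - i) * a J)"
    proof -
      have "0 \<le> g * (real J - real i)" using g iJ by simp
      then have "\<mu> * real J \<le> - (g * real i) + (- (g / 2) * (real J - real i) + \<kappa> * real J)"
        by (simp add: g_def field_simps)
      then have "2 powr (\<mu> * real J) * \<tau> J \<le> 2 powr (- (g * real i) + (- (g / 2) * (real J - real i) + \<kappa> * real J)) * \<tau> J"
        by (intro mult_right_mono powr_mono \<tau>_nonneg) auto
      then show ?thesis using split_power[OF iJ] by simp
    qed
    from e_J have "2 powr (\<mu> * real J) * e (2 ^ (J + c)) \<le> 2 powr (\<mu> * real J) * (real (block_start i - 1) * A / 2 ^ (Q * J)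
      + 2 * \<rho> * B * (\<Sum>j=i..<J. \<tau> j * (2 ^ (J - j) * \<theta> j) powr (- (1 / p'))) + B * \<tau> J)"
      by (intro mult_left_mono) auto
    also have "\<dots> = 2 powr (\<mu> * real J) * (real (block_start i - 1) * A / 2 ^ (Q * J))
      + 2 * \<rho> * B * (\<Sum>j=i..<J. 2 powr (\<mu> * real J) * (\<tau> j * (2 ^ (J - j) * \<theta> j) powr (- (1 / p'))))
      + B * (2 powr (\<mu> * real J) * \<tau> J)"
      by (simp add: distrib_left sum_distrib_left ac_simps)
    also have "\<dots> \<le> A * 2 powr (- (g * real i)) * (1 / 2) ^ i
        + K * (2 powr (- (g * real i)) * (\<Sum>j=i..<J. x ^ (j - i) * a j))
        + K * (2 powr (- (g * real i)) * (x ^ (J - i) * a J))"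
    proof (intro add_mono grid_error)
      have "0 \<le> 2 powr (- (g * real i)) * (\<Sum>j=i..<J. x ^ (j - i) * a j)"
        using x a0 by (intro mult_nonneg_nonneg sum_nonneg) auto
      then show "2 * \<rho> * B * (\<Sum>j=i..<J. 2 powr (\<mu> * real J) * (\<tau> j * (2 ^ (J - j) * \<theta> j) powr (- (1 / p'))))
          \<le> K * (2 powr (- (g * real i)) * (\<Sum>j=i..<J. x ^ (j - i) * a j))"
        unfolding block_errors by (rule mult_right_mono[OF K(2)])
      show "B * (2 powr (\<mu> * real J) * \<tau> J) \<le> K * (2 powr (- (g * real i)) * (x ^ (J - i) * a J))"
        using \<tau>_nonneg by (intro mult_mono[OF K(3) tail_error K(1)] mult_nonneg_nonneg) auto
    qed
    also have "\<dots> = A * 2 powr (- (g * real i)) * (1 / 2) ^ i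
        + K * 2 powr (- (g * real i)) * (\<Sum>j=i..<Suc J. x ^ (j - i) * a j)"
      using iJ by (simp add: distrib_left mult.assoc)
    also have "(\<Sum>j=i..<Suc J. x ^ (j - i) * a j) = (\<Sum>m<Suc J - i. x ^ m * a (i + m))"
      by (rule sum.reindex_bij_witness[of _ "\<lambda>m. i + m" "\<lambda>j. j - i"]) auto
    also have "A * 2 powr (- (g * real i)) * (1 / 2) ^ i + K * 2 powr (- (g * real i)) * (\<Sum>m<Suc J - i. x ^ m * a (i + m))
        \<le> A * 2 powr (- (g * real i)) * (1 / 2) ^ i + K * 2 powr (- (g * real i)) * h i"
      using K h_ge by (intro add_left_mono mult_left_mono) auto
    finally show ?thesis .
  qed

  \<comment> \<open>It remains to sum over \<open>J\<close>. Grouping the \<open>J\<close> with the same \<open>i\<close> amounts to a dyadic condensation of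
    \<open>F\<close> in the variable \<open>n = J + 2\<close>.\<close>
  define F where "F J = (real J + 1) powr g * (2 powr (\<mu> * real J) * e (2 ^ (J + c)))" for J
  have F0: "0 \<le> F J" for J using e_nonneg by (simp add: F_def)
  define H where "H l = 4 powr g * (A * (1 / 2) ^ (l - 1) + K * h (l - 1))" for l
  have F_le: "F J \<le> H (Suc i)" if i: "2 ^ Suc i \<le> J + 2" "J + 2 < 2 ^ Suc (Suc i)" for i J
  proof -
    have "real J + 1 \<le> 4 * 2 ^ i"
    proof -
      have "J + 1 \<le> 4 * 2 ^ i" using i(2) by simp
      then have "real (J + 1) \<le> real (4 * 2 ^ i)" by (simp only: of_nat_le_iff)
      then show ?thesis by simp
    qed
    then have "(real J + 1) powr g \<le> (4 * 2 ^ i) powr g" using g by (intro powr_mono2) auto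
    also have "\<dots> = 4 powr g * 2 powr (g * real i)"
      by (simp add: powr_mult powr_realpow[symmetric] powr_powr mult.commute)
    finally have "F J \<le> (4 powr g * 2 powr (g * real i)) *
        (A * 2 powr (- (g * real i)) * (1 / 2) ^ i + K * 2 powr (- (g * real i)) * h i)"
      unfolding F_def using e_bound[OF i(1)] e_nonneg by (intro mult_mono) auto
    also have "\<dots> = (4 powr g * (2 powr (g * real i) * 2 powr (- (g * real i)))) * (A * (1 / 2) ^ i + K * h i)"
      by (simp add: algebra_simps)
    also have "\<dots> = H (Suc i)" by (simp add: H_def powr_add[symmetric])
    finally show ?thesis .
  qed
  have "ell s (\<lambda>i. A * (1 / 2) ^ i)"
    by (rule ell_dominated[OF s ell_geometric[OF s, of "1 / 2"], of 0 _ A]) (use A in \<open>auto simp: abs_mult\<close>)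
  moreover have "ell s (\<lambda>i. K * h i)"
    by (rule ell_dominated[OF s h, of 0 _ K]) (use K in \<open>auto simp: abs_mult\<close>)
  ultimately have "ell s (\<lambda>i. A * (1 / 2) ^ i + K * h i)" by (rule ell_add[OF s])
  then have "ell s (\<lambda>i. H (i + 1))"
    by (rule ell_dominated[OF s, of _ 0 _ "4 powr g"]) (simp add: H_def abs_mult)
  then have "ell s H" by (subst (asm) ell_shift_iff[OF s])
  then have "ell s (\<lambda>n. real n powr (- \<omega>) * F (n - 2))"
    unfolding \<omega>_def
  \<comment> \<open>Indices below \<open>2\<close> are excluded because there \<open>n - 2\<close> is truncated.\<close>
  proof (rule ell_condense_intro[OF s, where L = 1])
    fix l n :: nat assume l: "1 \<le> l" and n: "2 ^ l \<le> n" "n < 2 ^ Suc l"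
    obtain i where i: "l = Suc i" using l by (cases l) auto
    have "2 \<le> n" using n(1) unfolding i by (rule order_trans[rotated]) simp
    then have "F (n - 2) \<le> H l" using F_le[of i "n - 2"] n by (simp add: i)
    then show "\<bar>F (n - 2)\<bar> \<le> \<bar>H l\<bar>" using F0[of "n - 2"] by linarith
  qed
  then have "ell s (\<lambda>n. real (n + 2) powr (- \<omega>) * F (n + 2 - 2))"
    using ell_shift_iff[OF s, of "\<lambda>n. real n powr (- \<omega>) * F (n - 2)" 2] by blast
  then have "ell s (\<lambda>J. dyadic_weight p' (\<omega> + \<mu> - \<kappa>) J * e (2 ^ (J + c)))"
  proof (rule ell_dominated[OF s, where N = 0])
    fix J :: nat
    have "dyadic_weight p' (\<omega> + \<mu> - \<kappa>) J * e (2 ^ (J + c)) = (real J + 1) powr (- \<omega>) * F J"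
    proof -
      have "- (\<omega> + \<mu> - \<kappa>) = - \<omega> + g" by (simp add: g_def)
      then have "(real J + 1) powr (- (\<omega> + \<mu> - \<kappa>)) = (real J + 1) powr (- \<omega>) * (real J + 1) powr g"
        by (simp only: powr_add)
      then show ?thesis
        unfolding dyadic_weight_def F_def by (simp add: \<mu>_def ac_simps)
    qed
    also have "\<dots> \<le> (2 powr \<bar>- \<omega>\<bar> * (real J + 2) powr (- \<omega>)) * F J"
      by (intro mult_right_mono F0 powr_comparable) auto
    finally show "\<bar>dyadic_weight p' (\<omega> + \<mu> - \<kappa>) J * e (2 ^ (J + c))\<bar>
        \<le> 2 powr \<omega> * \<bar>real (J + 2) powr (- \<omega>) * F (J + 2 - 2)\<bar>"
      using \<omega> F0[of J] e_nonneg dyadic_weight_pos[of p' _ J]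
      by (simp add: abs_mult less_imp_le add.commute)
  qed
  then show ?thesis unfolding \<omega>_def \<mu>_def \<kappa>_def by (rule lorentz_eI[OF s])
qed

end

theorem theorem5p1:
  fixes p p' :: real
    and S :: "l1 \<Rightarrow> 'a::banach"
    and \<sigma> :: "nat \<Rightarrow> real"
  assumes "1 < p" and "p \<le> 2"
    and "1 / p + 1 / p' = 1"
    and "has_type TYPE('a) p"
    and "bounded_linear S"
    and "antimono_on {1..} \<sigma>"
    and "\<forall>n\<ge>1. 0 \<le> \<sigma> n"
  shows
    "(\<forall>(r::real) (s::ereal). 0 < r \<and> r < p' \<and> 0 < s \<longrightarrow>
       (\<lambda>n. \<sigma> (2 ^ (n - 1))) \<in> lorentz r s 0 \<longrightarrow>
       (\<lambda>n. op_entropy_number n (S \<circ> diag_op \<sigma>))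
         \<in> lorentz p' s (real_of_ereal (1 / s) + 1 / p' - 1 / r)) \<and>
     (\<forall>(r::real) (s::ereal) (\<beta>::real). p' < r \<and> 0 < s \<longrightarrow>
       (\<lambda>n. \<sigma> (2 ^ (n - 1))) \<in> lorentz r s \<beta> \<longrightarrow>
       (\<lambda>n. op_entropy_number n (S \<circ> diag_op \<sigma>)) \<in> lorentz r s \<beta>)"
proof -
  obtain \<rho> where \<rho>: "0 < \<rho>" "type_bound TYPE('a) p \<rho>"
    using assms(4) unfolding has_type_def type_bound_def by blast
  obtain B where B: "0 \<le> B" "\<And>x. norm (S x) \<le> norm x * B"
    using bounded_linear.nonneg_bounded[OF assms(5)] by blast
  interpret type_diagonal p p' \<rho> B S \<sigma>
    by (rule type_diagonal.intro) (use assms \<rho> B in \<open>simp_all add: mult.commute[of B]\<close>)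
  show ?thesis
    using lorentz_below lorentz_above unfolding e_def[abs_def] by blast
qed

end
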